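(* Let $k\geq 2$ be an even integer. For $\alpha\in\mathbb{R}$ let $\lambda_1(\alpha)$ denote the lowest eigenvalue of the self-adjoint operator $Q^{(k)}(\alpha)=-\frac{d^2}{dt^2}+\Bigl(\frac{t^{k+1}}{k+1}-\alpha\Bigr)^2$ in $L^2(\mathbb{R})$. Then $\alpha=0$ is a non-degenerate local minimum of $\alpha\mapsto\lambda_1(\alpha)$.
   Context: For each $\alpha\in\mathbb{R}$ and integer $k\geq1$, $Q^{(k)}(\alpha)$ is the self-adjoint operator on $L^2(\mathbb{R})$ associated with the closed quadratic form $u\mapsto\int_{\mathbb{R}}|u'(t)|^2+\bigl(\frac{t^{k+1}}{k+1}-\alpha\bigr)^2|u(t)|^2\,dt$. It has compact resolvent and simple discrete spectrum; its lowest eigenvalue $\lambda_1(\alpha)$ depends smoothly on $\alpha$. Non-degenerate local minimum means $\partial_\alpha\lambda_1(0)=0$ and $\partial^2_{\alpha\alpha}\lambda_1(0)>0$. *)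

theory Defs
  imports "HOL-Analysis.Analysis"
begin

definition Qpot :: "nat \<Rightarrow> real \<Rightarrow> real \<Rightarrow> real" where
  "Qpot k \<alpha> t = (t ^ (k + 1) / real (k + 1) - \<alpha>) ^ 2"

text \<open>lam is an eigenvalue of Q^(k)(alpha): there is a nonzero (complex-valued)
  eigenfunction u.  Since the potential is smooth, eigenfunctions are smooth
  (elliptic regularity), so we require u to be C^2 and to satisfy the eigenvalue
  equation pointwise; membership in the form domain is expressed by
  u, u', (t^(k+1)/(k+1) - alpha) u being square integrable.\<close>

definition Q_eigenvalue :: "nat \<Rightarrow> real \<Rightarrow> real \<Rightarrow> bool" where
  "Q_eigenvalue k \<alpha> lam \<longleftrightarrow>
     (\<exists>u u' u'' :: real \<Rightarrow> complex.
        (\<exists>t. u t \<noteq> 0) \<and>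
        (\<forall>t. (u has_vector_derivative u' t) (at t)) \<and>
        (\<forall>t. (u' has_vector_derivative u'' t) (at t)) \<and>
        continuous_on UNIV u'' \<and>
        integrable lborel (\<lambda>t. (cmod (u t))\<^sup>2) \<and>
        integrable lborel (\<lambda>t. (cmod (u' t))\<^sup>2) \<and>
        integrable lborel (\<lambda>t. Qpot k \<alpha> t * (cmod (u t))\<^sup>2) \<and>
        (\<forall>t. - u'' t + complex_of_real (Qpot k \<alpha> t) * u t = complex_of_real lam * u t))"

definition lowest_eigenvalue :: "nat \<Rightarrow> real \<Rightarrow> real" where
  "lowest_eigenvalue k \<alpha> = Inf {lam. Q_eigenvalue k \<alpha> lam}"

end

theory Submission
  imports Defs
begin

text \<open>Write \<open>p t = t ^ (k + 1) / (k + 1)\<close>, let \<open>y > 0\<close> be the ground state at \<open>\<alpha> = 0\<close>, with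
  eigenvalue \<open>lam\<close>, and \<open>q = - y' / y\<close>, so that \<open>q' = lam - p\<^sup>2 + q\<^sup>2\<close>. Perturb the logarithmic
  derivative instead of the eigenfunction: \<open>q + \<alpha> s\<close> belongs to a solution of the eigenvalue equation at
  \<open>\<alpha>\<close> with eigenvalue \<open>lam + \<alpha>\<^sup>2 (1 - N)\<close> iff \<open>s' = 2 q s + 2 p + \<alpha> (s\<^sup>2 - N)\<close>. Boundedness of
  \<open>s\<close> forces \<open>N\<close> to be the average of \<open>s\<^sup>2\<close> with respect to the weight \<open>y\<^sup>2\<close>, because \<open>p\<close> is odd for even \<open>k\<close>.
  The linear problem \<open>s' = 2 q s + f - avg f\<close> is boundedly solvable in the supremum norm, so \<open>s\<close> and \<open>N\<close>
  are power series in \<open>\<alpha>\<close>; the solution obtained is positive and square integrable, hence the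
  ground state at \<open>\<alpha>\<close>.

  Thus the lowest eigenvalue is \<open>lam + \<alpha>\<^sup>2 (1 - N \<alpha>)\<close>, and everything reduces to \<open>N 0 < 1\<close>. At \<open>\<alpha> = 0\<close>,
  \<open>s t = - 2 y(t)\<^sup>-\<^sup>2 \<integral>\<^sub>t\<^sup>\<infinity> p y\<^sup>2\<close>. On the positive half line \<open>q \<ge> p\<close>, so
  \<open>- (y\<^sup>2)' \<ge> 2 p y\<^sup>2\<close> there and therefore \<open>\<bar>s\<bar> \<le> 1\<close>, not identically with equality.\<close>

section \<open>Positive eigenfunctions and the lowest eigenvalue\<close>

lemma not_integrable_if_bounded_below:
  fixes f :: "real \<Rightarrow> real"
  assumes f: "integrable lborel f" and c: "c > 0" and S: "emeasure lborel S = \<infinity>" "S \<in> sets lborel"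
    and ge: "\<And>t. t \<in> S \<Longrightarrow> c \<le> \<bar>f t\<bar>"
  shows False
proof -
  have "integrable lborel (\<lambda>t. indicator S t * c)"
  proof (rule Bochner_Integration.integrable_bound[OF f])
    show "(\<lambda>t. indicator S t * c) \<in> borel_measurable lborel" using S by simp
    show "AE t in lborel. norm (indicator S t * c) \<le> norm (f t)"
      using ge c by (auto intro!: AE_I2 simp: indicator_def)
  qed
  hence "integrable lborel (\<lambda>t. (indicator S t * c) * (1/c))" by (rule integrable_mult_left)
  hence "integrable lborel (indicator S :: real \<Rightarrow> real)" using c by simp
  thus False using S by (simp add: integrable_indicator_iff)
qed

lemma emeasure_lborel_Ici: "emeasure lborel {a::real..} = \<infinity>"
proof (rule ccontr)
  assume "emeasure lborel {a..} \<noteq> \<infinity>"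
  then obtain M where M: "emeasure lborel {a..} = ennreal M" "M \<ge> 0" by (cases "emeasure lborel {a..}") auto
  have "emeasure lborel {a..a+(M+1)} \<le> emeasure lborel {a..}" by (intro emeasure_mono) auto
  thus False using M by simp
qed

lemma emeasure_lborel_Iic: "emeasure lborel {..a::real} = \<infinity>"
proof (rule ccontr)
  assume "emeasure lborel {..a} \<noteq> \<infinity>"
  then obtain M where M: "emeasure lborel {..a} = ennreal M" "M \<ge> 0" by (cases "emeasure lborel {..a}") auto
  have "emeasure lborel {a-(M+1)..a} \<le> emeasure lborel {..a}" by (intro emeasure_mono) auto
  thus False using M by simp
qed

lemma integrable_mult_of_squares:
  fixes f g :: "real \<Rightarrow> real"
  assumes "integrable lborel (\<lambda>t. (f t)\<^sup>2)" "integrable lborel (\<lambda>t. (g t)\<^sup>2)"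
    and "f \<in> borel_measurable borel" "g \<in> borel_measurable borel"
  shows "integrable lborel (\<lambda>t. f t * g t)"
proof (rule Bochner_Integration.integrable_bound[OF Bochner_Integration.integrable_add[OF assms(1,2)]])
  show "(\<lambda>t. f t * g t) \<in> borel_measurable lborel" using assms(3,4) by simp
  have "\<bar>a * b\<bar> \<le> a\<^sup>2 + b\<^sup>2" for a b :: real
    using sum_squares_bound[of a b] sum_squares_bound[of a "-b"] zero_le_power2[of a] zero_le_power2[of b]
    by (auto simp: abs_if)
  thus "AE t in lborel. norm (f t * g t) \<le> norm ((f t)\<^sup>2 + (g t)\<^sup>2)" by (intro AE_I2) auto
qed

text \<open>With \<open>W = w' u - w u'\<close>, the function \<open>F = W w / u\<close> is nondecreasing and \<open>W\<^sup>2\<close> has derivative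
  \<open>2 (lam - mu) F u\<^sup>2\<close>. If \<open>F\<close> is nonzero at some point, \<open>W\<^sup>2\<close> is bounded below on a half line, although
  \<open>W\<close> is integrable.\<close>
lemma ground_state_lowest:
  fixes u u' w w' V :: "real \<Rightarrow> real"
  assumes u_pos: "\<And>t. u t > 0"
    and u: "\<And>t. (u has_real_derivative u' t) (at t)"
    and u': "\<And>t. (u' has_real_derivative (V t - lam) * u t) (at t)"
    and w: "\<And>t. (w has_real_derivative w' t) (at t)"
    and w': "\<And>t. (w' has_real_derivative (V t - mu) * w t) (at t)"
    and iu: "integrable lborel (\<lambda>t. (u t)\<^sup>2)" "integrable lborel (\<lambda>t. (u' t)\<^sup>2)"
    and iw: "integrable lborel (\<lambda>t. (w t)\<^sup>2)" "integrable lborel (\<lambda>t. (w' t)\<^sup>2)"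
    and nz: "w t0 \<noteq> 0"
  shows "lam \<le> mu"
proof (rule ccontr)
  assume "\<not> lam \<le> mu"
  define e where "e = lam - mu"
  have e: "e > 0" using \<open>\<not> lam \<le> mu\<close> by (simp add: e_def)
  have meas: "f \<in> borel_measurable borel"
    if "\<And>t. (f has_real_derivative f' t) (at t)" for f f' :: "real \<Rightarrow> real"
    using that by (intro borel_measurable_continuous_onI continuous_at_imp_continuous_on ballI)
      (auto intro: DERIV_isCont)
  define W where "W = (\<lambda>t. w' t * u t - w t * u' t)"
  define F where "F = (\<lambda>t. W t * (w t / u t))"
  have iW: "integrable lborel W"
    unfolding W_def using iu iw meas[OF u] meas[OF u'] meas[OF w] meas[OF w']
    by (intro Bochner_Integration.integrable_diff integrable_mult_of_squares) simp_all
  have W: "(W has_real_derivative e * (w t * u t)) (at t)" for t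
    unfolding W_def e_def
    by (rule derivative_eq_intros u u' w w' refl)+ (simp add: algebra_simps)
  have une: "u t \<noteq> 0" for t using u_pos[of t] by simp
  \<comment> \<open>Picone's identity: \<open>(w / u)' = W / u^2\<close>, so both terms of the
    derivative of \<open>F\<close> are nonnegative.\<close>
  have F: "(F has_real_derivative e * (w t)\<^sup>2 + (W t)\<^sup>2 / (u t)\<^sup>2) (at t)" for t
    unfolding F_def
    by (rule derivative_eq_intros W u u' w w' refl une)+
      (use une[of t] in \<open>simp add: W_def field_simps power2_eq_square\<close>)
  have W2: "((\<lambda>t. (W t)\<^sup>2) has_real_derivative 2 * e * (F t * (u t)\<^sup>2)) (at t)" for t
    by (rule derivative_eq_intros W refl)+
      (use une[of t] in \<open>simp add: F_def field_simps power2_eq_square\<close>)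
  have Fmono: "F s \<le> F t" if "s \<le> t" for s t
    by (rule DERIV_nonneg_imp_nondecreasing[OF that]) (use F e in \<open>force intro!: add_nonneg_nonneg mult_nonneg_nonneg\<close>)
  have "F t = 0" for t
  proof (rule ccontr)
    assume "F t \<noteq> 0"
    then consider "F t > 0" | "F t < 0" by linarith
    thus False
    proof cases
      case 1
      hence "W t \<noteq> 0" by (auto simp: F_def)
      have ge: "(W t)\<^sup>2 \<le> (W s)\<^sup>2" if "t \<le> s" for s
      proof (rule DERIV_nonneg_imp_nondecreasing[OF that])
        fix x assume "t \<le> x" "x \<le> s"
        hence "F x \<ge> 0" using Fmono[of t x] 1 by linarith
        thus "\<exists>y. ((\<lambda>t. (W t)\<^sup>2) has_real_derivative y) (at x) \<and> 0 \<le> y"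
          using e by (intro exI[of _ "2 * e * (F x * (u x)\<^sup>2)"] conjI W2) auto
      qed
      have "\<bar>W t\<bar> \<le> \<bar>W s\<bar>" if "s \<in> {t..}" for s
        using ge[of s] that by (simp add: abs_le_square_iff)
      from not_integrable_if_bounded_below[OF iW _ emeasure_lborel_Ici _ this] \<open>W t \<noteq> 0\<close>
      show False by auto
    next
      case 2
      hence "W t \<noteq> 0" by (auto simp: F_def)
      have ge: "(W t)\<^sup>2 \<le> (W s)\<^sup>2" if "s \<le> t" for s
      proof (rule DERIV_nonpos_imp_nonincreasing[OF that])
        fix x assume "s \<le> x" "x \<le> t"
        hence "F x \<le> 0" using Fmono[of x t] 2 by linarith
        thus "\<exists>y. ((\<lambda>t. (W t)\<^sup>2) has_real_derivative y) (at x) \<and> y \<le> 0"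
          using e by (intro exI[of _ "2 * e * (F x * (u x)\<^sup>2)"] conjI W2) (auto simp: mult_le_0_iff)
      qed
      have "\<bar>W t\<bar> \<le> \<bar>W s\<bar>" if "s \<in> {..t}" for s
        using ge[of s] that by (simp add: abs_le_square_iff)
      from not_integrable_if_bounded_below[OF iW _ emeasure_lborel_Iic _ this] \<open>W t \<noteq> 0\<close>
      show False by auto
    qed
  qed
  hence "F = (\<lambda>_. 0)" by auto
  with F[of t0] have "((\<lambda>_. 0) has_real_derivative e * (w t0)\<^sup>2 + (W t0)\<^sup>2 / (u t0)\<^sup>2) (at t0)"
    by metis
  hence "e * (w t0)\<^sup>2 + (W t0)\<^sup>2 / (u t0)\<^sup>2 = 0"
    by (rule DERIV_unique) (rule DERIV_const)
  moreover have "e * (w t0)\<^sup>2 > 0" using e nz by simp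
  moreover have "(W t0)\<^sup>2 / (u t0)\<^sup>2 \<ge> 0" by simp
  ultimately show False by linarith
qed

text \<open>The potential and \<open>mu\<close> are real, so the real and imaginary parts of a
  complex eigenfunction solve the same equation and inherit square integrability. At least one of
  them is nonzero somewhere; the comparison is applied to that one, with \<open>pr\<close> standing
  for \<open>Re\<close> or \<open>Im\<close>.\<close>

lemma Q_eigenvalue_ge_ground_state:
  fixes u u' :: "real \<Rightarrow> real"
  assumes u_pos: "\<And>t. u t > 0"
    and u: "\<And>t. (u has_real_derivative u' t) (at t)"
    and u': "\<And>t. (u' has_real_derivative (Qpot k \<alpha> t - lam) * u t) (at t)"
    and iu: "integrable lborel (\<lambda>t. (u t)\<^sup>2)" "integrable lborel (\<lambda>t. (u' t)\<^sup>2)"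
    and ev: "Q_eigenvalue k \<alpha> mu"
  shows "lam \<le> mu"
proof -
  obtain v v' v'' :: "real \<Rightarrow> complex" where
    nz: "\<exists>t. v t \<noteq> 0" and v: "\<And>t. (v has_vector_derivative v' t) (at t)"
    and v': "\<And>t. (v' has_vector_derivative v'' t) (at t)"
    and iv: "integrable lborel (\<lambda>t. (cmod (v t))\<^sup>2)" "integrable lborel (\<lambda>t. (cmod (v' t))\<^sup>2)"
    and eq: "\<And>t. - v'' t + complex_of_real (Qpot k \<alpha> t) * v t = complex_of_real mu * v t"
    using ev unfolding Q_eigenvalue_def by blast
  have v'': "v'' t = complex_of_real (Qpot k \<alpha> t - mu) * v t" for t
    using eq[of t] by (simp add: algebra_simps)
  have meas: "f \<in> borel_measurable borel"
    if "\<And>t. (f has_vector_derivative f' t) (at t)" for f f' :: "real \<Rightarrow> complex"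
    using that by (intro borel_measurable_continuous_onI continuous_at_imp_continuous_on ballI)
      (auto intro: has_vector_derivative_continuous)
  have key: "lam \<le> mu" if pr: "bounded_linear pr" and le: "\<And>z. \<bar>pr z\<bar> \<le> cmod z"
    and mult: "\<And>a z. pr (complex_of_real a * z) = a * pr z" and n: "pr (v t0) \<noteq> 0"
    for pr :: "complex \<Rightarrow> real" and t0
  proof (rule ground_state_lowest[OF u_pos u u' _ _ iu])
    show "((\<lambda>t. pr (v t)) has_real_derivative pr (v' t)) (at t)" for t
      unfolding has_real_derivative_iff_has_vector_derivative
      by (rule bounded_linear.has_vector_derivative[OF pr v])
    show "((\<lambda>t. pr (v' t)) has_real_derivative (Qpot k \<alpha> t - mu) * pr (v t)) (at t)" for t
      using bounded_linear.has_vector_derivative[OF pr v'[of t]]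
      unfolding has_real_derivative_iff_has_vector_derivative v'' mult by simp
    have mp: "pr \<in> borel_measurable borel"
      by (intro borel_measurable_continuous_onI linear_continuous_on pr)
    have int: "integrable lborel (\<lambda>t. (pr (f t))\<^sup>2)"
      if "integrable lborel (\<lambda>t. (cmod (f t))\<^sup>2)" "f \<in> borel_measurable borel" for f :: "real \<Rightarrow> complex"
    proof (rule Bochner_Integration.integrable_bound[OF that(1)])
      show "(\<lambda>t. (pr (f t))\<^sup>2) \<in> borel_measurable lborel"
        using measurable_compose[OF that(2) mp] by simp
      show "AE t in lborel. norm ((pr (f t))\<^sup>2) \<le> norm ((cmod (f t))\<^sup>2)"
        using le by (intro AE_I2) (simp add: abs_le_square_iff[symmetric])
    qed
    show "integrable lborel (\<lambda>t. (pr (v t))\<^sup>2)" "integrable lborel (\<lambda>t. (pr (v' t))\<^sup>2)"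
      by (auto intro!: int iv meas v v')
    show "pr (v t0) \<noteq> 0" by (rule n)
  qed
  obtain t0 where "v t0 \<noteq> 0" using nz by blast
  hence "Re (v t0) \<noteq> 0 \<or> Im (v t0) \<noteq> 0" by (simp add: complex_eq_iff)
  thus ?thesis
  proof
    assume "Re (v t0) \<noteq> 0"
    thus ?thesis by (intro key[of Re]) (auto simp: abs_Re_le_cmod bounded_linear_Re)
  next
    assume "Im (v t0) \<noteq> 0"
    thus ?thesis by (intro key[of Im]) (auto simp: abs_Im_le_cmod bounded_linear_Im)
  qed
qed

lemma Q_eigenvalue_of_real_solution:
  fixes u u' :: "real \<Rightarrow> real"
  assumes nz: "u t0 \<noteq> 0"
    and u: "\<And>t. (u has_real_derivative u' t) (at t)"
    and u': "\<And>t. (u' has_real_derivative (Qpot k \<alpha> t - lam) * u t) (at t)"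
    and iu: "integrable lborel (\<lambda>t. (u t)\<^sup>2)" "integrable lborel (\<lambda>t. (u' t)\<^sup>2)"
      "integrable lborel (\<lambda>t. Qpot k \<alpha> t * (u t)\<^sup>2)"
  shows "Q_eigenvalue k \<alpha> lam"
  unfolding Q_eigenvalue_def
proof (rule exI[of _ "\<lambda>t. complex_of_real (u t)"], rule exI[of _ "\<lambda>t. complex_of_real (u' t)"],
    rule exI[of _ "\<lambda>t. complex_of_real ((Qpot k \<alpha> t - lam) * u t)"], intro conjI allI)
  show "\<exists>t. complex_of_real (u t) \<noteq> 0" using nz by auto
  show "((\<lambda>t. complex_of_real (u t)) has_vector_derivative complex_of_real (u' t)) (at t)" for t
    using u by (intro has_vector_derivative_of_real) (simp add: has_real_derivative_iff_has_vector_derivative)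
  show "((\<lambda>t. complex_of_real (u' t)) has_vector_derivative
      complex_of_real ((Qpot k \<alpha> t - lam) * u t)) (at t)" for t
    using u' by (intro has_vector_derivative_of_real) (simp add: has_real_derivative_iff_has_vector_derivative)
  have "continuous_on UNIV u"
    by (intro continuous_at_imp_continuous_on ballI) (rule DERIV_isCont[OF u])
  thus "continuous_on UNIV (\<lambda>t. complex_of_real ((Qpot k \<alpha> t - lam) * u t))"
    unfolding Qpot_def by (intro continuous_intros) auto
  show "integrable lborel (\<lambda>t. (cmod (complex_of_real (u t)))\<^sup>2)"
    "integrable lborel (\<lambda>t. (cmod (complex_of_real (u' t)))\<^sup>2)"
    "integrable lborel (\<lambda>t. Qpot k \<alpha> t * (cmod (complex_of_real (u t)))\<^sup>2)"
    using iu by simp_all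
qed (simp add: algebra_simps)

text \<open>Positivity replaces spectral theory here: a positive square integrable solution is
  itself an eigenfunction, and no eigenvalue lies below its own. From here on it suffices to exhibit
  such a solution for each parameter.\<close>

lemma lowest_eigenvalue_eqI:
  fixes u u' :: "real \<Rightarrow> real"
  assumes u_pos: "\<And>t. u t > 0"
    and u: "\<And>t. (u has_real_derivative u' t) (at t)"
    and u': "\<And>t. (u' has_real_derivative (Qpot k \<alpha> t - lam) * u t) (at t)"
    and iu: "integrable lborel (\<lambda>t. (u t)\<^sup>2)" "integrable lborel (\<lambda>t. (u' t)\<^sup>2)"
      "integrable lborel (\<lambda>t. Qpot k \<alpha> t * (u t)\<^sup>2)"
  shows "lowest_eigenvalue k \<alpha> = lam"
  unfolding lowest_eigenvalue_def
proof (rule cInf_eq_minimum)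
  show "lam \<in> {lam. Q_eigenvalue k \<alpha> lam}"
    using Q_eigenvalue_of_real_solution[OF _ u u' iu, of 0] u_pos[of 0] by simp
qed (use Q_eigenvalue_ge_ground_state[OF u_pos u u' iu(1,2)] in auto)

section \<open>Square integrability from exponential decay\<close>

text \<open>The antiderivative is monotone and bounded, hence converges to its supremum, and the
  fundamental theorem makes the integral over the half line finite.\<close>

lemma integrable_of_bounded_antiderivative:
  fixes f F :: "real \<Rightarrow> real"
  assumes f: "continuous_on UNIV f"
    and F: "\<And>t. a \<le> t \<Longrightarrow> (F has_real_derivative f t) (at t)"
    and nonneg: "\<And>t. a \<le> t \<Longrightarrow> 0 \<le> f t"
    and bdd: "\<And>t. a \<le> t \<Longrightarrow> F t \<le> B"
  shows "integrable lborel (\<lambda>t. indicator {a..} t * f t)"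
proof -
  have mono: "F s \<le> F t" if "a \<le> s" "s \<le> t" for s t
    using that F nonneg by (intro DERIV_nonneg_imp_nondecreasing[of s t F]) (auto intro: order_trans)
  define L where "L = (SUP t\<in>{a..}. F t)"
  have bd: "bdd_above (F ` {a..})" using bdd by (intro bdd_aboveI2[where M = B]) auto
  have lim: "(F \<longlongrightarrow> L) at_top"
  proof (rule increasing_tendsto)
    show "eventually (\<lambda>t. F t \<le> L) at_top"
      using eventually_ge_at_top[of a] by eventually_elim (auto simp: L_def intro!: cSUP_upper bd)
    fix x assume "x < L"
    then obtain t where t: "t \<ge> a" "x < F t" using less_cSUP_iff[OF _ bd, of x] by (auto simp: L_def)
    show "eventually (\<lambda>s. x < F s) at_top"
      using eventually_ge_at_top[of t] by eventually_elim (use t mono in force)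
  qed
  have fm[measurable]: "f \<in> borel_measurable borel" using f by (rule borel_measurable_continuous_onI)
  have "(\<integral>\<^sup>+x. ennreal (f x) * indicator {a ..} x \<partial>lborel) = L - F a"
    by (rule nn_integral_FTC_atLeast[OF fm F nonneg lim])
  also have "(\<integral>\<^sup>+x. ennreal (f x) * indicator {a ..} x \<partial>lborel) =
      (\<integral>\<^sup>+x. ennreal (indicator {a..} x * f x) \<partial>lborel)"
    by (intro nn_integral_cong) (auto simp: indicator_def)
  finally show ?thesis
    using nonneg by (intro integrableI_nonneg AE_I2) (auto simp: indicator_def)
qed

lemma integrable_from_tails:
  fixes g :: "real \<Rightarrow> real"
  assumes g: "continuous_on UNIV g"
    and r: "integrable lborel (\<lambda>t. indicator {a..} t * g t)"
    and l: "integrable lborel (\<lambda>t. indicator {a..} t * g (- t))"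
  shows "integrable lborel g"
proof -
  have l': "integrable lborel (\<lambda>t. indicator {a..} (-t) * g t)"
    using lborel_integrable_real_affine[OF l, of "-1" 0] by simp
  have m: "integrable lborel (\<lambda>t. indicator {-\<bar>a\<bar>..\<bar>a\<bar>} t * g t)"
    using borel_integrable_compact[of "{-\<bar>a\<bar>..\<bar>a\<bar>}" g] continuous_on_subset[OF g]
    by (simp add: mult.commute)
  have "integrable lborel (\<lambda>t. \<bar>indicator {a..} t * g t\<bar> + \<bar>indicator {a..} (-t) * g t\<bar>
      + \<bar>indicator {-\<bar>a\<bar>..\<bar>a\<bar>} t * g t\<bar>)"
    by (intro Bochner_Integration.integrable_add integrable_abs r l' m)
  thus ?thesis
  proof (rule Bochner_Integration.integrable_bound)
    show "g \<in> borel_measurable lborel" using borel_measurable_continuous_onI[OF g] by simp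
  qed (auto intro!: AE_I2 simp: indicator_def abs_mult)
qed

text \<open>Each integrand is compared with the derivative of a bounded monotone function. The decay
  gives \<open>u^2 \<le> - 2 * u * u'\<close>, the derivative of \<open>- u^2\<close>; and
  \<open>u * u' \<le> 0\<close> has derivative \<open>u'^2 + (V - lam) * u^2\<close>, a sum of
  nonnegative terms. The integrability of \<open>V * u^2\<close> follows by linear
  combination.\<close>

lemma decay_imp_square_integrable_right:
  fixes u u' V :: "real \<Rightarrow> real"
  assumes u_pos: "\<And>t. u t > 0"
    and u: "\<And>t. (u has_real_derivative u' t) (at t)"
    and u': "\<And>t. (u' has_real_derivative (V t - lam) * u t) (at t)"
    and V: "continuous_on UNIV V"
    and decay: "\<And>t. a \<le> t \<Longrightarrow> u' t \<le> - u t / 2" "\<And>t. a \<le> t \<Longrightarrow> lam \<le> V t"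
  shows "integrable lborel (\<lambda>t. indicator {a..} t * (u t)\<^sup>2)"
    and "integrable lborel (\<lambda>t. indicator {a..} t * (u' t)\<^sup>2)"
    and "integrable lborel (\<lambda>t. indicator {a..} t * (V t * (u t)\<^sup>2))"
proof -
  have cu[continuous_intros]: "continuous_on UNIV u" and cu'[continuous_intros]: "continuous_on UNIV u'"
    by (intro continuous_at_imp_continuous_on ballI DERIV_isCont[OF u] DERIV_isCont[OF u'])+
  note V[continuous_intros]
  have [measurable]: "u \<in> borel_measurable borel" "u' \<in> borel_measurable borel"
    using cu cu' by (auto intro: borel_measurable_continuous_onI)
  have uu': "u t * u' t \<le> - (u t)\<^sup>2 / 2" if "a \<le> t" for t
    using mult_left_mono[OF decay(1)[OF that], of "u t"] u_pos[of t] by (simp add: power2_eq_square)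
  have 1: "integrable lborel (\<lambda>t. indicator {a..} t * (- 2 * (u t * u' t)))"
  proof (rule integrable_of_bounded_antiderivative[where F = "\<lambda>t. - (u t)\<^sup>2" and B = 0])
    show "((\<lambda>t. - (u t)\<^sup>2) has_real_derivative - 2 * (u t * u' t)) (at t)" for t
      by (rule derivative_eq_intros u refl)+ simp
    show "0 \<le> - 2 * (u t * u' t)" if "a \<le> t" for t
      using uu'[OF that] zero_le_power2[of "u t"] by linarith
  qed (auto intro!: continuous_intros)
  show i1: "integrable lborel (\<lambda>t. indicator {a..} t * (u t)\<^sup>2)"
  proof (rule Bochner_Integration.integrable_bound[OF 1])
    show "AE t in lborel. norm (indicator {a..} t * (u t)\<^sup>2) \<le> norm (indicator {a..} t * (- 2 * (u t * u' t)))"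
    proof (rule AE_I2)
      fix t
      show "norm (indicator {a..} t * (u t)\<^sup>2) \<le> norm (indicator {a..} t * (- 2 * (u t * u' t)))"
        using uu'[of t] by (auto simp: indicator_def)
    qed
  qed simp
  have 2: "integrable lborel (\<lambda>t. indicator {a..} t * ((u' t)\<^sup>2 + (V t - lam) * (u t)\<^sup>2))"
  proof (rule integrable_of_bounded_antiderivative[where F = "\<lambda>t. u t * u' t" and B = 0])
    show "((\<lambda>t. u t * u' t) has_real_derivative (u' t)\<^sup>2 + (V t - lam) * (u t)\<^sup>2) (at t)" for t
      by (rule derivative_eq_intros u u' refl)+ (simp add: power2_eq_square)
    show "0 \<le> (u' t)\<^sup>2 + (V t - lam) * (u t)\<^sup>2" if "a \<le> t" for t
      using decay(2)[OF that] by simp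
    show "u t * u' t \<le> 0" if "a \<le> t" for t
      using uu'[OF that] zero_le_power2[of "u t"] by linarith
  qed (auto intro!: continuous_intros)
  show i2: "integrable lborel (\<lambda>t. indicator {a..} t * (u' t)\<^sup>2)"
  proof (rule Bochner_Integration.integrable_bound[OF 2])
    show "AE t in lborel. norm (indicator {a..} t * (u' t)\<^sup>2) \<le>
        norm (indicator {a..} t * ((u' t)\<^sup>2 + (V t - lam) * (u t)\<^sup>2))"
    proof (rule AE_I2)
      fix t
      show "norm (indicator {a..} t * (u' t)\<^sup>2) \<le>
        norm (indicator {a..} t * ((u' t)\<^sup>2 + (V t - lam) * (u t)\<^sup>2))"
        using decay(2)[of t] by (cases "a \<le> t") (auto simp: indicator_def)
    qed
  qed simp
  have "integrable lborel (\<lambda>t. indicator {a..} t * ((u' t)\<^sup>2 + (V t - lam) * (u t)\<^sup>2)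
      - indicator {a..} t * (u' t)\<^sup>2 + lam * (indicator {a..} t * (u t)\<^sup>2))"
    by (intro Bochner_Integration.integrable_add Bochner_Integration.integrable_diff
        integrable_mult_right i1 i2 2)
  thus "integrable lborel (\<lambda>t. indicator {a..} t * (V t * (u t)\<^sup>2))"
    by (simp add: algebra_simps)
qed

lemma decay_imp_square_integrable:
  fixes u u' V :: "real \<Rightarrow> real"
  assumes u_pos: "\<And>t. u t > 0"
    and u: "\<And>t. (u has_real_derivative u' t) (at t)"
    and u': "\<And>t. (u' has_real_derivative (V t - lam) * u t) (at t)"
    and V: "continuous_on UNIV V"
    and right: "\<And>t. a \<le> t \<Longrightarrow> u' t \<le> - u t / 2" "\<And>t. a \<le> t \<Longrightarrow> lam \<le> V t"
    and left: "\<And>t. t \<le> - a \<Longrightarrow> u t / 2 \<le> u' t" "\<And>t. t \<le> - a \<Longrightarrow> lam \<le> V t"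
  shows "integrable lborel (\<lambda>t. (u t)\<^sup>2)"
    and "integrable lborel (\<lambda>t. (u' t)\<^sup>2)"
    and "integrable lborel (\<lambda>t. V t * (u t)\<^sup>2)"
proof -
  have cu[continuous_intros]: "continuous_on UNIV u" and cu'[continuous_intros]: "continuous_on UNIV u'"
    by (intro continuous_at_imp_continuous_on ballI DERIV_isCont[OF u] DERIV_isCont[OF u'])+
  note R = decay_imp_square_integrable_right[OF u_pos u u' V right]
  \<comment> \<open>The left half line is reduced to the right one by reflection.\<close>
  have v: "((\<lambda>t. u (- t)) has_real_derivative - u' (- t)) (at t)" for t
    using DERIV_chain2[OF u DERIV_minus[OF DERIV_ident], of t] by simp
  have v': "((\<lambda>t. - u' (- t)) has_real_derivative (V (- t) - lam) * u (- t)) (at t)" for t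
    using DERIV_minus[OF DERIV_chain2[OF u' DERIV_minus[OF DERIV_ident], of t]] by simp
  have cV: "continuous_on UNIV (\<lambda>t. V (- t))"
    by (intro continuous_on_compose2[OF V]) (auto intro!: continuous_intros)
  have "- u' (- t) \<le> - u (- t) / 2" "lam \<le> V (- t)" if "a \<le> t" for t
    using left[of "- t"] that by auto
  note L = decay_imp_square_integrable_right[OF u_pos v v' cV this]
  note V[continuous_intros]
  show "integrable lborel (\<lambda>t. (u t)\<^sup>2)"
    by (rule integrable_from_tails[OF _ R(1) L(1)]) (intro continuous_intros)
  show "integrable lborel (\<lambda>t. (u' t)\<^sup>2)"
    by (rule integrable_from_tails[OF _ R(2)]) (use L(2) in \<open>auto intro!: continuous_intros\<close>)
  show "integrable lborel (\<lambda>t. V t * (u t)\<^sup>2)"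
    by (rule integrable_from_tails[OF _ R(3) L(3)]) (intro continuous_intros)
qed

section \<open>Linear second order equations\<close>

lemma gronwall:
  fixes E E' :: "real \<Rightarrow> real"
  assumes E: "\<And>t. 0 \<le> t \<Longrightarrow> t \<le> T \<Longrightarrow> (E has_real_derivative E' t) (at t)"
    and le: "\<And>t. 0 \<le> t \<Longrightarrow> t \<le> T \<Longrightarrow> E' t \<le> K * E t + G"
    and K: "0 \<le> K" and G: "0 \<le> G" and t: "0 \<le> t" "t \<le> T"
  shows "E t \<le> (E 0 + G * t) * exp (K * t)"
proof -
  \<comment> \<open>Integrating factor: the derivative is
    \<open>(E' - K * E) * exp (- K * s) - G\<close>, which is nonpositive because the exponential is
    at most 1 and \<open>G\<close> is nonnegative.\<close>
  have "E t * exp (- (K * t)) - G * t \<le> E 0 * exp (- (K * 0)) - G * 0"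
  proof (rule DERIV_nonpos_imp_nonincreasing[OF t(1)])
    fix s assume s: "0 \<le> s" "s \<le> t"
    have "(E' s - K * E s) * exp (- (K * s)) \<le> G * 1"
      using le[of s] s t K G by (intro mult_mono) auto
    moreover have "((\<lambda>t. E t * exp (- (K * t)) - G * t) has_real_derivative
        (E' s - K * E s) * exp (- (K * s)) - G) (at s)"
      using s t by (auto intro!: derivative_eq_intros E simp: algebra_simps)
    ultimately show "\<exists>y. ((\<lambda>t. E t * exp (- (K * t)) - G * t) has_real_derivative y) (at s) \<and> y \<le> 0"
      by force
  qed
  hence "E t * exp (- (K * t)) \<le> E 0 + G * t" by simp
  hence "E t * exp (- (K * t)) * exp (K * t) \<le> (E 0 + G * t) * exp (K * t)"
    by (intro mult_right_mono) auto
  thus ?thesis by (simp add: exp_minus mult.assoc)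
qed

text \<open>The energy \<open>E = y^2 + y'^2\<close> satisfies
  \<open>E' \<le> (2 + C) * E + G^2\<close>, by \<open>2 * a * b \<le> a^2 + b^2\<close> in each
  product, and Gronwall applies with \<open>E 0 = 0\<close>. The case \<open>G = 0\<close> gives
  uniqueness, small \<open>G\<close> gives continuous dependence on the eigenvalue
  parameter.\<close>

lemma linear_ode_estimate:
  fixes y y' c g :: "real \<Rightarrow> real"
  assumes y: "\<And>t. (y has_real_derivative y' t) (at t)"
    and y': "\<And>t. (y' has_real_derivative c t * y t + g t) (at t)"
    and init: "y 0 = 0" "y' 0 = 0"
    and c: "\<And>t. 0 \<le> t \<Longrightarrow> t \<le> T \<Longrightarrow> \<bar>c t\<bar> \<le> C"
    and g: "\<And>t. 0 \<le> t \<Longrightarrow> t \<le> T \<Longrightarrow> \<bar>g t\<bar> \<le> G"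
    and t: "0 \<le> t" "t \<le> T"
  shows "(y t)\<^sup>2 + (y' t)\<^sup>2 \<le> G\<^sup>2 * t * exp ((2 + C) * t)"
proof -
  have C: "0 \<le> C" using c[of 0] t by force
  have "(y t)\<^sup>2 + (y' t)\<^sup>2 \<le> ((y 0)\<^sup>2 + (y' 0)\<^sup>2 + G\<^sup>2 * t) * exp ((2 + C) * t)"
  proof (rule gronwall[where E = "\<lambda>t. (y t)\<^sup>2 + (y' t)\<^sup>2" and T = T])
    fix s assume s: "0 \<le> s" "s \<le> T"
    show "((\<lambda>t. (y t)\<^sup>2 + (y' t)\<^sup>2) has_real_derivative
        2 * y s * y' s + 2 * y' s * (c s * y s + g s)) (at s)"
      by (rule derivative_eq_intros y y' refl)+ (simp add: algebra_simps)
    have ab: "2 * (a * b) \<le> a\<^sup>2 + b\<^sup>2" for a b :: real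
      using sum_squares_bound[of a b] by simp
    have "2 * y s * y' s \<le> (y s)\<^sup>2 + (y' s)\<^sup>2" using ab[of "y s" "y' s"] by (simp add: mult.assoc)
    moreover have "2 * y' s * (c s * y s) \<le> C * ((y s)\<^sup>2 + (y' s)\<^sup>2)"
    proof -
      have "2 * y' s * (c s * y s) \<le> \<bar>c s\<bar> * \<bar>2 * (y s * y' s)\<bar>"
        using abs_ge_self[of "c s * (2 * (y s * y' s))"] by (simp only: abs_mult mult_ac)
      also have "\<dots> \<le> C * ((y s)\<^sup>2 + (y' s)\<^sup>2)"
        using c[OF s] C ab[of "y s" "y' s"] ab[of "- y s" "y' s"] by (intro mult_mono) (auto simp: abs_if)
      finally show ?thesis .
    qed
    moreover have "2 * y' s * g s \<le> (y' s)\<^sup>2 + G\<^sup>2"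
    proof -
      have "(g s)\<^sup>2 \<le> G\<^sup>2" using g[OF s] by (simp add: abs_le_square_iff[symmetric])
      thus ?thesis using ab[of "y' s" "g s"] by (simp add: mult.assoc)
    qed
    moreover have "0 \<le> (y s)\<^sup>2" by simp
    ultimately show "2 * y s * y' s + 2 * y' s * (c s * y s + g s) \<le>
        (2 + C) * ((y s)\<^sup>2 + (y' s)\<^sup>2) + G\<^sup>2"
      unfolding distrib_left distrib_right by linarith
  qed (use C t in auto)
  thus ?thesis by (simp add: init)
qed

text \<open>Uniqueness for the initial value problem. The estimate runs forward from 0, so the
  solution is translated to start at \<open>a\<close>, and reflected when \<open>t\<close> lies to
  the left of \<open>a\<close>.\<close>

lemma linear_ode_zero:
  fixes y y' c :: "real \<Rightarrow> real"
  assumes y: "\<And>t. (y has_real_derivative y' t) (at t)"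
    and y': "\<And>t. (y' has_real_derivative c t * y t) (at t)"
    and c: "continuous_on UNIV c"
    and init: "y a = 0" "y' a = 0"
  shows "y t = 0"
proof -
  have forward: "z T = 0" if z: "\<And>t. (z has_real_derivative z' t) (at t)"
    and z': "\<And>t. (z' has_real_derivative d t * z t) (at t)" and d: "continuous_on UNIV d"
    and zi: "z 0 = 0" "z' 0 = 0" and T: "0 \<le> T" for z z' d :: "real \<Rightarrow> real" and T
  proof -
    have "bounded (d ` {0..T})"
      by (intro compact_imp_bounded compact_continuous_image continuous_on_subset[OF d]) auto
    then obtain C where C: "\<And>t. 0 \<le> t \<Longrightarrow> t \<le> T \<Longrightarrow> \<bar>d t\<bar> \<le> C"
      unfolding bounded_iff by force
    have "(z T)\<^sup>2 + (z' T)\<^sup>2 \<le> 0\<^sup>2 * T * exp ((2 + C) * T)"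
      by (rule linear_ode_estimate[where g = "\<lambda>_. 0" and c = d and T = T]) (use z z' zi C T in auto)
    hence "(z T)\<^sup>2 + (z' T)\<^sup>2 \<le> 0" by simp
    thus ?thesis by (simp add: sum_power2_le_zero_iff)
  qed
  show ?thesis
  proof (cases "a \<le> t")
    case True
    have "y (a + (t - a)) = 0"
    proof (rule forward[where z = "\<lambda>s. y (a + s)" and T = "t - a" and z' = "\<lambda>s. y' (a + s)" and d = "\<lambda>s. c (a + s)"])
      have i: "((+) a has_real_derivative 1) (at s)" for s by (auto intro!: derivative_eq_intros)
      show "((\<lambda>s. y (a + s)) has_real_derivative y' (a + s)) (at s)" for s
        using DERIV_chain2[OF y i] by simp
      show "((\<lambda>s. y' (a + s)) has_real_derivative c (a + s) * y (a + s)) (at s)" for s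
        using DERIV_chain2[OF y' i] by simp
    qed (use True init in \<open>auto intro!: continuous_on_compose2[OF c] continuous_intros\<close>)
    thus ?thesis by simp
  next
    case False
    have "y (a - (a - t)) = 0"
    proof (rule forward[where z = "\<lambda>s. y (a - s)" and T = "a - t" and z' = "\<lambda>s. - y' (a - s)" and d = "\<lambda>s. c (a - s)"])
      have i: "((-) a has_real_derivative -1) (at s)" for s by (auto intro!: derivative_eq_intros)
      show "((\<lambda>s. y (a - s)) has_real_derivative - y' (a - s)) (at s)" for s
        using DERIV_chain2[OF y i] by simp
      show "((\<lambda>s. - y' (a - s)) has_real_derivative c (a - s) * y (a - s)) (at s)" for s
        using DERIV_minus[OF DERIV_chain2[OF y' i]] by simp
    qed (use False init in \<open>auto intro!: continuous_on_compose2[OF c] continuous_intros\<close>)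
    thus ?thesis by simp
  qed
qed

text \<open>Taylor coefficients of the solution of \<open>y'' = (A * t ^ N - lam) * y\<close> with
  \<open>y 0 = 1\<close> and \<open>y' 0 = 0\<close>, found by comparing the coefficients of
  \<open>t ^ n\<close>.\<close>

fun ode_coeff :: "real \<Rightarrow> nat \<Rightarrow> real \<Rightarrow> nat \<Rightarrow> real" where
  "ode_coeff A N lam 0 = 1"
| "ode_coeff A N lam (Suc 0) = 0"
| "ode_coeff A N lam (Suc (Suc n)) =
     ((if N \<le> n then A * ode_coeff A N lam (n - N) else 0) - lam * ode_coeff A N lam n)
       / (real (Suc n) * real (Suc (Suc n)))"

text \<open>It suffices that \<open>\<bar>a n\<bar> * R ^ n\<close> stays bounded for some
  \<open>R > \<bar>x\<bar>\<close>; then a geometric series dominates. The threshold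
  \<open>n0\<close> is chosen so that from there on the denominator of the recurrence exceeds
  \<open>R^2 * (\<bar>A\<bar> * R ^ N + \<bar>lam\<bar>)\<close>, which lets the bound
  \<open>B\<close> on the first terms propagate by induction.\<close>

lemma summable_ode_coeff: "summable (\<lambda>n. ode_coeff A N lam n * x ^ n)"
proof -
  define a where "a = ode_coeff A N lam"
  define R where "R = \<bar>x\<bar> + 1"
  define n0 where "n0 = nat \<lceil>R\<^sup>2 * (\<bar>A\<bar> * R ^ N + \<bar>lam\<bar>)\<rceil>"
  define B where "B = (\<Sum>i<n0+2. \<bar>a i\<bar> * R ^ i)"
  have R: "R > 0" by (simp add: R_def)
  have small: "\<bar>a i\<bar> * R ^ i \<le> B" if "i < n0 + 2" for i
    unfolding B_def using that R by (intro member_le_sum) auto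
  have B: "0 \<le> B" unfolding B_def using R by (intro sum_nonneg) auto
  have bound: "\<bar>a n\<bar> * R ^ n \<le> B" for n
  proof (induction n rule: less_induct)
    case (less n)
    show ?case
    proof (cases "n < n0 + 2")
      case False
      define k where "k = n - 2"
      have k: "n = Suc (Suc k)" "n0 \<le> k" using False by (auto simp: k_def)
      define D where "D = real (Suc k) * real (Suc (Suc k))"
      have "R\<^sup>2 * (\<bar>A\<bar> * R ^ N + \<bar>lam\<bar>) \<le> real n0" unfolding n0_def by linarith
      also have "\<dots> \<le> real (Suc k) * 1" using k by simp
      also have "\<dots> \<le> D" unfolding D_def by (intro mult_left_mono) auto
      finally have D: "R\<^sup>2 * (\<bar>A\<bar> * R ^ N + \<bar>lam\<bar>) \<le> D" .
      have D0: "D > 0" by (simp add: D_def)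
      have 1: "\<bar>if N \<le> k then A * a (k - N) else 0\<bar> * R ^ k \<le> \<bar>A\<bar> * R ^ N * B"
      proof (cases "N \<le> k")
        case True
        have "\<bar>A * a (k - N)\<bar> * R ^ k = \<bar>A\<bar> * R ^ N * (\<bar>a (k - N)\<bar> * R ^ (k - N))"
          using True by (simp add: abs_mult power_add[symmetric] mult_ac)
        also have "\<dots> \<le> \<bar>A\<bar> * R ^ N * B" using R k by (intro mult_left_mono less.IH) auto
        finally show ?thesis using True by simp
      qed (use R B in auto)
      have 2: "\<bar>lam * a k\<bar> * R ^ k \<le> \<bar>lam\<bar> * B"
        using mult_left_mono[OF less.IH[of k], of "\<bar>lam\<bar>"] k by (simp add: abs_mult mult_ac)
      have "\<bar>a n\<bar> * R ^ n = R\<^sup>2 * (\<bar>(if N \<le> k then A * a (k - N) else 0) - lam * a k\<bar> * R ^ k) / D"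
        using k D0 by (simp add: a_def D_def abs_mult power2_eq_square mult_ac)
      also have "\<dots> \<le> R\<^sup>2 * ((\<bar>if N \<le> k then A * a (k - N) else 0\<bar> + \<bar>lam * a k\<bar>) * R ^ k) / D"
        using R D0 by (intro divide_right_mono mult_left_mono mult_right_mono abs_triangle_ineq4) auto
      also have "\<dots> \<le> R\<^sup>2 * (\<bar>A\<bar> * R ^ N * B + \<bar>lam\<bar> * B) / D"
        using 1 2 D0 by (intro divide_right_mono mult_left_mono) (auto simp: distrib_right)
      also have "\<dots> = (R\<^sup>2 * (\<bar>A\<bar> * R ^ N + \<bar>lam\<bar>)) * B / D" by (simp add: algebra_simps)
      also have "\<dots> \<le> D * B / D" using D B D0 by (intro divide_right_mono mult_right_mono) auto
      finally show ?thesis using D0 by simp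
    qed (use small in auto)
  qed
  have "summable (\<lambda>n. a n * x ^ n)"
  proof (rule summable_comparison_test')
    show "summable (\<lambda>n. B * (\<bar>x\<bar> / R) ^ n)"
      using R by (intro summable_mult summable_geometric) (auto simp: R_def)
    fix n :: nat
    have "norm (a n * x ^ n) = \<bar>a n\<bar> * R ^ n * (\<bar>x\<bar> / R) ^ n"
      using R by (simp add: abs_mult power_abs power_divide)
    also have "\<dots> \<le> B * (\<bar>x\<bar> / R) ^ n" using bound R by (intro mult_right_mono) auto
    finally show "norm (a n * x ^ n) \<le> B * (\<bar>x\<bar> / R) ^ n" .
  qed
  thus ?thesis by (simp add: a_def)
qed

lemma linear_ode_exists:
  obtains y y' :: "real \<Rightarrow> real" where "y 0 = 1" "y' 0 = 0"
    "\<And>t. (y has_real_derivative y' t) (at t)"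
    "\<And>t. (y' has_real_derivative (A * t ^ N - lam) * y t) (at t)"
proof
  define a where "a = ode_coeff A N lam"
  have sa: "summable (\<lambda>n. a n * x ^ n)" for x unfolding a_def by (rule summable_ode_coeff)
  have sa': "summable (\<lambda>n. diffs a n * x ^ n)" for x by (rule termdiff_converges_all[OF sa])
  define y where "y = (\<lambda>x. \<Sum>n. a n * x ^ n)"
  define y' where "y' = (\<lambda>x. \<Sum>n. diffs a n * x ^ n)"
  show "y 0 = 1" "y' 0 = 0" by (simp_all add: y_def y'_def a_def diffs_def)
  show "(y has_real_derivative y' t) (at t)" for t
    unfolding y_def y'_def by (rule termdiffs_strong_converges_everywhere[OF sa])
  show "(y' has_real_derivative (A * t ^ N - lam) * y t) (at t)" for t
  proof -
    have d: "(y' has_real_derivative (\<Sum>n. diffs (diffs a) n * t ^ n)) (at t)"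
      unfolding y'_def by (rule termdiffs_strong_converges_everywhere[OF sa'])
    have "diffs (diffs a) n = (if N \<le> n then A * a (n - N) else 0) - lam * a n" for n
    proof -
      have "diffs (diffs a) n = (real (Suc n) * real (Suc (Suc n))) * a (Suc (Suc n))"
        by (simp add: diffs_def)
      also have "\<dots> = (if N \<le> n then A * a (n - N) else 0) - lam * a n"
        unfolding a_def ode_coeff.simps by (simp del: of_nat_Suc)
      finally show ?thesis .
    qed
    hence eq: "(\<lambda>n. diffs (diffs a) n * t ^ n) =
      (\<lambda>n. (if N \<le> n then A * a (n - N) else 0) * t ^ n - lam * (a n * t ^ n))"
      by (simp add: left_diff_distrib mult.assoc)
    have ys: "(\<lambda>n. a n * t ^ n) sums y t" unfolding y_def by (rule summable_sums[OF sa])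
    \<comment> \<open>Multiplication by \<open>t ^ N\<close> shifts the coefficients by
      \<open>N\<close> places, and the first \<open>N\<close> coefficients of the shifted series are
      zero.\<close>
    have "(\<lambda>n. A * t ^ N * (a n * t ^ n)) sums (A * t ^ N * y t)" by (rule sums_mult[OF ys])
    also have "(\<lambda>n. A * t ^ N * (a n * t ^ n)) =
        (\<lambda>n. (if N \<le> n + N then A * a (n + N - N) else 0) * t ^ (n + N))"
      by (auto simp: power_add mult_ac)
    finally have "(\<lambda>n. (if N \<le> n then A * a (n - N) else 0) * t ^ n) sums (A * t ^ N * y t)"
      by (subst (asm) sums_zero_iff_shift) auto
    from sums_diff[OF this sums_mult[OF ys, of lam]]
    have "(\<lambda>n. diffs (diffs a) n * t ^ n) sums ((A * t ^ N - lam) * y t)"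
      unfolding eq by (simp add: algebra_simps)
    thus ?thesis using d by (simp add: sums_iff)
  qed
qed

section \<open>The ground state of the symmetric potential\<close>

text \<open>In the region \<open>V \<ge> lam\<close> the product \<open>y * y'\<close> has
  derivative \<open>y'^2 + (V - lam) * y^2 \<ge> 0\<close>. It therefore stays nonnegative, so
  \<open>y^2\<close> cannot decrease and \<open>y\<close> has no zero there.\<close>

lemma positive_beyond_barrier:
  fixes y y' V :: "real \<Rightarrow> real"
  assumes y: "\<And>t. (y has_real_derivative y' t) (at t)"
    and y': "\<And>t. (y' has_real_derivative (V t - lam) * y t) (at t)"
    and init: "y a > 0" "y' a \<ge> 0"
    and V: "\<And>t. a \<le> t \<Longrightarrow> lam \<le> V t" and t: "a \<le> t"
  shows "y t > 0"
proof -
  have prod: "((\<lambda>t. y t * y' t) has_real_derivative (y' s)\<^sup>2 + (V s - lam) * (y s)\<^sup>2) (at s)" for s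
    by (rule derivative_eq_intros y y' refl)+ (simp add: power2_eq_square)
  have yy': "0 \<le> y s * y' s" if s: "a \<le> s" for s
  proof -
    have "y a * y' a \<le> y s * y' s"
    proof (rule DERIV_nonneg_imp_nondecreasing[OF s])
      fix x assume "a \<le> x" "x \<le> s"
      show "\<exists>d. ((\<lambda>t. y t * y' t) has_real_derivative d) (at x) \<and> 0 \<le> d"
        using prod[of x] V[OF \<open>a \<le> x\<close>]
        by (intro exI[of _ "(y' x)\<^sup>2 + (V x - lam) * (y x)\<^sup>2"]) auto
    qed
    thus ?thesis using init mult_nonneg_nonneg[of "y a" "y' a"] by linarith
  qed
  have sq: "((\<lambda>t. (y t)\<^sup>2) has_real_derivative 2 * (y s * y' s)) (at s)" for s
    by (rule derivative_eq_intros y refl)+ simp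
  have ne: "y s \<noteq> 0" if s: "a \<le> s" for s
  proof -
    have "(y a)\<^sup>2 \<le> (y s)\<^sup>2"
    proof (rule DERIV_nonneg_imp_nondecreasing[OF s])
      fix x assume "a \<le> x" "x \<le> s"
      show "\<exists>d. ((\<lambda>t. (y t)\<^sup>2) has_real_derivative d) (at x) \<and> 0 \<le> d"
        using sq[of x] yy'[OF \<open>a \<le> x\<close>] by (intro exI[of _ "2 * (y x * y' x)"]) auto
    qed
    moreover have "0 < (y a)\<^sup>2" using init by simp
    ultimately show ?thesis by auto
  qed
  show ?thesis
  proof (rule ccontr)
    assume "\<not> y t > 0"
    hence "\<exists>x\<ge>a. x \<le> t \<and> y x = 0"
      using init t by (intro IVT2) (auto intro: DERIV_isCont[OF y])
    thus False using ne by blast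
  qed
qed

text \<open>A zero at \<open>t > 0\<close> would be a local minimum, tested on the neighbourhood of
  radius \<open>t\<close>, which stays in the positive half line. Then \<open>y'\<close> vanishes
  there as well, and uniqueness makes \<open>y\<close> identically zero.\<close>

lemma positive_if_nonneg:
  fixes y y' c :: "real \<Rightarrow> real"
  assumes y: "\<And>t. (y has_real_derivative y' t) (at t)"
    and y': "\<And>t. (y' has_real_derivative c t * y t) (at t)"
    and c: "continuous_on UNIV c"
    and nonneg: "\<And>t. 0 \<le> t \<Longrightarrow> 0 \<le> y t" and init: "y 0 > 0" and t: "0 \<le> t"
  shows "y t > 0"
proof (rule ccontr)
  assume "\<not> y t > 0"
  with nonneg[OF t] have yt: "y t = 0" by simp
  with init t have "t > 0" by (cases "t = 0") auto
  have "y' t = 0"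
    by (rule DERIV_local_min[OF y \<open>t > 0\<close>]) (use yt nonneg in auto)
  from linear_ode_zero[OF y y' c yt this, of 0] init show False by simp
qed

text \<open>The eigenvalue is the infimum of all \<open>lam\<close> whose even solution with value 1 at 0 becomes negative. If the
  solution at the infimum ever increased, it would stay positive behind the barrier, and so would
  those for slightly larger \<open>lam\<close>.\<close>
lemma shooting_ground_state:
  fixes m :: nat
  assumes m: "m \<ge> 1"
  defines "V \<equiv> (\<lambda>t::real. 1 / (real m)\<^sup>2 * t ^ (2 * m))"
  obtains lam :: real and y y' where "lam > 0" "y 0 = 1" "y' 0 = 0"
    "\<And>t. (y has_real_derivative y' t) (at t)"
    "\<And>t. (y' has_real_derivative (V t - lam) * y t) (at t)"
    "\<And>t. y t > 0" "\<And>t. 0 \<le> t \<Longrightarrow> y' t \<le> 0"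
    "\<And>t. y (- t) = y t" "\<And>t. y' (- t) = - y' t"
proof -
  have "\<exists>y y'. y 0 = 1 \<and> y' 0 = 0 \<and> (\<forall>t. (y has_real_derivative y' t) (at t)) \<and>
    (\<forall>t. (y' has_real_derivative (V t - lam) * y t) (at t))" for lam
    unfolding V_def by (rule linear_ode_exists[of "1 / (real m)\<^sup>2" "2 * m" lam]) blast
  then obtain Y Y' where Y0: "\<And>lam. Y lam 0 = 1" and Y'0: "\<And>lam. Y' lam 0 = 0"
    and Y: "\<And>lam t. (Y lam has_real_derivative Y' lam t) (at t)"
    and Y': "\<And>lam t. (Y' lam has_real_derivative (V t - lam) * Y lam t) (at t)"
    by metis
  have V_nonneg: "0 \<le> V t" for t by (simp add: V_def)
  have V_mono: "V s \<le> V t" if "0 \<le> s" "s \<le> t" for s t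
    unfolding V_def using that by (intro mult_left_mono power_mono) auto
  have V1: "V 1 \<le> 1" using m by (simp add: V_def)
  have V_cont: "continuous_on S (\<lambda>t. V t - lam)" for S lam
    unfolding V_def by (intro continuous_intros)
  have Y_cont: "continuous_on S (Y lam)" for S lam
    by (intro continuous_at_imp_continuous_on ballI DERIV_isCont[OF Y])
  have V_large: "\<exists>t\<ge>a. B \<le> V t" for a B
  proof (intro exI conjI)
    define t where "t = max (max a 1) (B * (real m)\<^sup>2)"
    show "a \<le> t" by (simp add: t_def)
    have "B * (real m)\<^sup>2 \<le> t ^ 1" by (simp add: t_def)
    also have "\<dots> \<le> t ^ (2 * m)" using m by (intro power_increasing) (auto simp: t_def)
    finally show "B \<le> V t" using m by (simp add: V_def field_simps)
  qed

  \<comment> \<open>Continuous dependence on the eigenvalue parameter, uniformly on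
    \<open>{0..T}\<close>: the difference of two solutions has zero initial data and forcing term
    \<open>(lam - mu) * Y lam\<close>.\<close>
  have cont: "\<exists>d>0. \<forall>mu. \<bar>mu - lam\<bar> < d \<longrightarrow> (\<forall>t. 0 \<le> t \<and> t \<le> T \<longrightarrow>
      \<bar>Y mu t - Y lam t\<bar> < e \<and> \<bar>Y' mu t - Y' lam t\<bar> < e)"
    if e: "e > 0" and T: "0 \<le> T" for lam T e
  proof -
    have "bounded (Y lam ` {0..T})"
      by (intro compact_imp_bounded compact_continuous_image Y_cont) auto
    then obtain M where M: "\<And>t. 0 \<le> t \<Longrightarrow> t \<le> T \<Longrightarrow> \<bar>Y lam t\<bar> \<le> M"
      unfolding bounded_iff by force
    \<comment> \<open>\<open>C\<close> bounds \<open>\<bar>V - mu\<bar>\<close> for all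
      \<open>mu\<close> within distance 1 of \<open>lam\<close>. \<open>Q\<close> makes the energy
      estimate read at most \<open>\<bar>mu - lam\<bar>^2 * Q\<close>; the summand 1 keeps
      \<open>Q\<close> positive.\<close>
    define C where "C = V T + \<bar>lam\<bar> + 1"
    define Q where "Q = M\<^sup>2 * T * exp ((2 + C) * T) + 1"
    have Q: "Q > 0" unfolding Q_def using T by (intro add_nonneg_pos mult_nonneg_nonneg) auto
    show ?thesis
    proof (intro exI[of _ "min 1 (e / sqrt Q)"] conjI allI impI)
      show "0 < min 1 (e / sqrt Q)" using e Q by simp
      fix mu t assume mu: "\<bar>mu - lam\<bar> < min 1 (e / sqrt Q)" and t: "0 \<le> t \<and> t \<le> T"
      have "(Y mu t - Y lam t)\<^sup>2 + (Y' mu t - Y' lam t)\<^sup>2 \<le> (\<bar>mu - lam\<bar> * M)\<^sup>2 * t * exp ((2 + C) * t)"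
      proof (rule linear_ode_estimate[where y = "\<lambda>t. Y mu t - Y lam t" and T = T
            and y' = "\<lambda>t. Y' mu t - Y' lam t" and c = "\<lambda>t. V t - mu" and g = "\<lambda>t. (lam - mu) * Y lam t"])
        show "((\<lambda>t. Y mu t - Y lam t) has_real_derivative Y' mu t - Y' lam t) (at t)" for t
          by (intro DERIV_diff Y)
        show "((\<lambda>t. Y' mu t - Y' lam t) has_real_derivative
            (V t - mu) * (Y mu t - Y lam t) + (lam - mu) * Y lam t) (at t)" for t
          by (rule derivative_eq_intros Y' refl)+ (simp add: algebra_simps)
        show "\<bar>V t - mu\<bar> \<le> C" if "0 \<le> t" "t \<le> T" for t
          using V_mono[OF that] V_nonneg[of t] mu unfolding C_def by linarith
        show "\<bar>(lam - mu) * Y lam t\<bar> \<le> \<bar>mu - lam\<bar> * M" if "0 \<le> t" "t \<le> T" for t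
          using M[OF that] by (auto simp: abs_mult abs_minus_commute intro!: mult_left_mono)
      qed (use t in \<open>auto simp: Y0 Y'0\<close>)
      also have "\<dots> = \<bar>mu - lam\<bar>\<^sup>2 * (M\<^sup>2 * t * exp ((2 + C) * t))"
        by (simp add: power_mult_distrib)
      also have "\<dots> \<le> \<bar>mu - lam\<bar>\<^sup>2 * Q"
      proof (intro mult_left_mono)
        have "(2 + C) * t \<le> (2 + C) * T"
          using t V_nonneg[of T] by (intro mult_left_mono) (auto simp: C_def)
        hence "M\<^sup>2 * t * exp ((2 + C) * t) \<le> M\<^sup>2 * T * exp ((2 + C) * T)"
          using t by (intro mult_mono) auto
        thus "M\<^sup>2 * t * exp ((2 + C) * t) \<le> Q" by (simp add: Q_def)
      qed auto
      also have "\<dots> = (\<bar>mu - lam\<bar> * sqrt Q)\<^sup>2" using Q by (simp add: power_mult_distrib)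
      also have "\<dots> < e\<^sup>2"
      proof (rule power_strict_mono)
        show "\<bar>mu - lam\<bar> * sqrt Q < e" using mu Q by (simp add: field_simps)
      qed (use Q in auto)
      finally have lt: "(Y mu t - Y lam t)\<^sup>2 + (Y' mu t - Y' lam t)\<^sup>2 < e\<^sup>2" .
      have "(Y mu t - Y lam t)\<^sup>2 < e\<^sup>2" "(Y' mu t - Y' lam t)\<^sup>2 < e\<^sup>2"
        using lt zero_le_power2[of "Y mu t - Y lam t"] zero_le_power2[of "Y' mu t - Y' lam t"] by linarith+
      thus "\<bar>Y mu t - Y lam t\<bar> < e" "\<bar>Y' mu t - Y' lam t\<bar> < e"
        using e power2_less_imp_less[of "\<bar>Y mu t - Y lam t\<bar>" e]
          power2_less_imp_less[of "\<bar>Y' mu t - Y' lam t\<bar>" e] by simp_all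
    qed
  qed

  define Z where "Z = {lam. \<exists>t\<ge>0. Y lam t < 0}"
  have pos: "Y lam t > 0" if "lam \<notin> Z" "0 \<le> t" for lam t
    by (rule positive_if_nonneg[OF Y Y' V_cont]) (use that in \<open>auto simp: Z_def Y0 not_less\<close>)
  have Z_pos: "0 \<le> lam" if lam: "lam \<in> Z" for lam
  proof (rule ccontr)
    assume neg: "\<not> 0 \<le> lam"
    obtain t where t: "t \<ge> 0" "Y lam t < 0" using lam by (auto simp: Z_def)
    have "Y lam t > 0"
    proof (rule positive_beyond_barrier[OF Y Y' _ _ _ t(1)])
      show "lam \<le> V s" for s using V_nonneg[of s] neg by linarith
    qed (auto simp: Y0 Y'0)
    thus False using t by simp
  qed
  have bdd: "bdd_below Z" using Z_pos by (rule bdd_belowI)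
  \<comment> \<open>Sturm comparison with \<open>cos (pi * t)\<close> on \<open>{0..1/2}\<close>,
    where \<open>V \<le> 1\<close>. If the solution stayed positive, the Wronskian \<open>W\<close>
    would be nonincreasing from \<open>W 0 = 0\<close>, whereas
    \<open>W (1/2) = pi * Y lam (1/2)\<close>.\<close>
  have "1 + pi\<^sup>2 \<in> Z"
  proof (rule ccontr)
    assume nZ: "1 + pi\<^sup>2 \<notin> Z"
    define lam where "lam = 1 + pi\<^sup>2"
    define W where "W = (\<lambda>t. Y' lam t * cos (pi * t) + Y lam t * (pi * sin (pi * t)))"
    have "W (1/2) \<le> W 0"
    proof (rule DERIV_nonpos_imp_nonincreasing[of 0 "1/2" W])
      fix t :: real assume t: "0 \<le> t" "t \<le> 1/2"
      have "(W has_real_derivative (V t - 1) * (Y lam t * cos (pi * t))) (at t)"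
        unfolding W_def
        by (rule derivative_eq_intros Y Y' refl)+ (simp add: lam_def algebra_simps power2_eq_square)
      moreover have "V t \<le> 1" using V_mono[of t 1] V1 t by simp
      moreover have "cos (pi * t) \<ge> 0"
      proof (rule cos_ge_zero)
        have "0 \<le> pi * t" using t by simp
        thus "- (pi / 2) \<le> pi * t" using pi_gt_zero by linarith
        show "pi * t \<le> pi / 2" using t mult_left_mono[of t "1/2" pi] by simp
      qed
      moreover have "Y lam t > 0" using pos nZ t by (simp add: lam_def)
      ultimately show "\<exists>d. (W has_real_derivative d) (at t) \<and> d \<le> 0"
        by (intro exI[of _ "(V t - 1) * (Y lam t * cos (pi * t))"]) (auto intro: mult_nonpos_nonneg)
    qed simp
    hence "Y lam (1/2) \<le> 0" using pi_gt_zero by (auto simp: W_def Y'0 mult_le_0_iff)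
    with pos[OF nZ, of "1/2"] show False by (simp add: lam_def)
  qed
  hence ne: "Z \<noteq> {}" by blast

  define lam where "lam = Inf Z"
  \<comment> \<open>Negativity at a point survives a small decrease of the parameter, so the infimum
    of \<open>Z\<close> is not attained.\<close>
  have nZ: "lam \<notin> Z"
  proof
    assume "lam \<in> Z"
    then obtain t where t: "t \<ge> 0" "Y lam t < 0" by (auto simp: Z_def)
    from cont[of "- Y lam t" t lam] t obtain d where d: "d > 0" and
      near: "\<And>mu. \<bar>mu - lam\<bar> < d \<Longrightarrow> \<bar>Y mu t - Y lam t\<bar> < - Y lam t" by auto
    have "Y (lam - d/2) t < 0" using near[of "lam - d/2"] d by auto
    hence "lam - d/2 \<in> Z" using t by (auto simp: Z_def)
    hence "lam \<le> lam - d/2" unfolding lam_def by (rule cInf_lower[OF _ bdd])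
    thus False using d by simp
  qed
  note pos = pos[OF nZ]
  have dec: "Y' lam t1 \<le> 0" if t1: "0 \<le> t1" for t1
  proof (rule ccontr)
    assume "\<not> Y' lam t1 \<le> 0"
    hence up: "Y' lam t1 > 0" by simp
    \<comment> \<open>\<open>Y' lam\<close> starts at 0 and is nonincreasing as long as
      \<open>V\<close> stays below \<open>lam\<close>, so it can become positive only behind the
      barrier.\<close>
    have V1: "lam \<le> V t1"
    proof (rule ccontr)
      assume V1: "\<not> lam \<le> V t1"
      have "Y' lam t1 \<le> Y' lam 0"
      proof (rule DERIV_nonpos_imp_nonincreasing[OF t1])
        fix t assume t: "0 \<le> t" "t \<le> t1"
        have "V t \<le> lam" using V_mono[OF t] V1 by simp
        hence "(V t - lam) * Y lam t \<le> 0" using pos[of t] t by (intro mult_nonpos_nonneg) auto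
        thus "\<exists>d. (Y' lam has_real_derivative d) (at t) \<and> d \<le> 0" using Y' by blast
      qed
      thus False using up by (simp add: Y'0)
    qed
    \<comment> \<open>The extra 1 makes \<open>t2\<close> lie behind the barrier for every parameter
      up to \<open>lam + 1\<close> at once.\<close>
    obtain t2 where t2: "t1 \<le> t2" "lam + 1 \<le> V t2" using V_large by blast
    have "Y' lam t1 \<le> Y' lam t2"
    proof (rule DERIV_nonneg_imp_nondecreasing[OF t2(1)])
      fix t assume t: "t1 \<le> t" "t \<le> t2"
      have "lam \<le> V t" using V_mono[OF t1 t(1)] V1 by simp
      hence "0 \<le> (V t - lam) * Y lam t" using pos[of t] t t1 by (intro mult_nonneg_nonneg) auto
      thus "\<exists>d. (Y' lam has_real_derivative d) (at t) \<and> 0 \<le> d" using Y' by blast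
    qed
    hence up2: "Y' lam t2 > 0" using up by simp
    have "\<exists>s\<in>{0..t2}. \<forall>t\<in>{0..t2}. Y lam s \<le> Y lam t"
      by (rule continuous_attains_inf) (use t1 t2 Y_cont in auto)
    then obtain s where s: "0 \<le> s" "\<And>t. 0 \<le> t \<Longrightarrow> t \<le> t2 \<Longrightarrow> Y lam s \<le> Y lam t" by auto
    \<comment> \<open>This tolerance preserves both facts needed for nearby \<open>mu\<close>:
      positivity on all of \<open>{0..t2}\<close>, where \<open>Y lam s\<close> is the minimum, and
      a positive slope at \<open>t2\<close>.\<close>
    from cont[of "min (Y lam s) (Y' lam t2)" t2 lam] obtain d where d: "d > 0" and
      near: "\<And>mu t. \<bar>mu - lam\<bar> < d \<Longrightarrow> 0 \<le> t \<Longrightarrow> t \<le> t2 \<Longrightarrow>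
        \<bar>Y mu t - Y lam t\<bar> < min (Y lam s) (Y' lam t2) \<and> \<bar>Y' mu t - Y' lam t\<bar> < min (Y lam s) (Y' lam t2)"
      using pos[OF s(1)] up2 t1 t2 by auto
    have "Inf Z < lam + min d 1" using d by (simp add: lam_def)
    then obtain mu where mu: "mu \<in> Z" "mu < lam + min d 1"
      using cInf_less_iff[OF ne bdd] by blast
    have "lam \<le> mu" unfolding lam_def using mu by (intro cInf_lower bdd)
    hence mu_near: "\<bar>mu - lam\<bar> < d" "mu \<le> lam + 1" using mu by auto
    obtain t where t: "t \<ge> 0" "Y mu t < 0" using mu by (auto simp: Z_def)
    have early: "Y mu r > 0" if "0 \<le> r" "r \<le> t2" for r
      using near[OF mu_near(1) that] s(2)[OF that] by linarith
    have "Y mu t > 0"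
    proof (cases "t \<le> t2")
      case False
      have "0 \<le> t2" using t1 t2 by simp
      show ?thesis
      proof (rule positive_beyond_barrier[OF Y Y'])
        show "Y mu t2 > 0" using early \<open>0 \<le> t2\<close> by simp
        show "Y' mu t2 \<ge> 0" using near[OF mu_near(1) \<open>0 \<le> t2\<close> order_refl] by linarith
        show "mu \<le> V r" if "t2 \<le> r" for r
          using V_mono[OF \<open>0 \<le> t2\<close> that] t2 mu_near by linarith
      qed (use False in auto)
    qed (use early t in auto)
    thus False using t by simp
  qed
  have "0 \<le> lam" unfolding lam_def by (rule cInf_greatest[OF ne Z_pos])
  \<comment> \<open>For \<open>lam = 0\<close> the solution would be convex, with slope rising
    strictly above 0 by time 1, against \<open>dec\<close>.\<close>
  moreover have "lam \<noteq> 0"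
  proof
    assume "lam = 0"
    hence D: "(Y' lam has_real_derivative V t * Y lam t) (at t)" for t using Y'[of lam t] by simp
    have "Y' lam 0 \<le> Y' lam (1/2)"
    proof (rule DERIV_nonneg_imp_nondecreasing[of 0 "1/2" "Y' lam"])
      fix t :: real assume "0 \<le> t" "t \<le> 1/2"
      thus "\<exists>d. (Y' lam has_real_derivative d) (at t) \<and> 0 \<le> d"
        using D[of t] V_nonneg[of t] pos[of t] by (intro exI[of _ "V t * Y lam t"]) auto
    qed simp
    also have "\<dots> < Y' lam 1"
    proof (rule DERIV_pos_imp_increasing[of "1/2" 1 "Y' lam"])
      fix t :: real assume t: "1/2 \<le> t" "t \<le> 1"
      have "V t > 0" using t m by (simp add: V_def)
      thus "\<exists>d. (Y' lam has_real_derivative d) (at t) \<and> 0 < d"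
        using D[of t] pos[of t] t by (intro exI[of _ "V t * Y lam t"]) auto
    qed simp
    finally show False using dec[of 1] by (simp add: Y'0)
  qed
  ultimately have lam_pos: "lam > 0" by simp

  have ref: "((\<lambda>t. Y lam (- t)) has_real_derivative - Y' lam (- t)) (at t)" for t
    using DERIV_chain2[OF Y DERIV_minus[OF DERIV_ident], of lam t] by simp
  have V_even: "V (- t) = V t" for t by (simp add: V_def)
  have ref': "((\<lambda>t. - Y' lam (- t)) has_real_derivative (V t - lam) * Y lam (- t)) (at t)" for t
    using DERIV_minus[OF DERIV_chain2[OF Y' DERIV_minus[OF DERIV_ident], of lam t]] V_even by simp
  have dif: "((\<lambda>t. Y lam (- t) - Y lam t) has_real_derivative (- Y' lam (- t) - Y' lam t)) (at t)" for t
    by (intro DERIV_diff ref Y)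
  have "Y lam (- t) - Y lam t = 0" for t
  proof (rule linear_ode_zero[where a = 0, OF dif _ V_cont])
    show "((\<lambda>t. - Y' lam (- t) - Y' lam t) has_real_derivative
        (V t - lam) * (Y lam (- t) - Y lam t)) (at t)" for t
      using DERIV_diff[OF ref'[of t] Y'[of lam t]] by (simp add: algebra_simps)
  qed (auto simp: Y0 Y'0)
  hence even: "Y lam (- t) = Y lam t" for t by simp
  have odd: "Y' lam (- t) = - Y' lam t" for t
    using DERIV_unique[OF ref[of t, unfolded even] Y[of lam t]] by simp
  have "Y lam t > 0" for t using pos[of t] pos[of "- t"] even[of t] by (cases "0 \<le> t") auto
  from that[OF lam_pos Y0 Y'0 Y Y' this dec even odd] show ?thesis .
qed

lemma power_over_exponent:
  "n \<ge> 1 \<Longrightarrow> ((\<lambda>t::real. t ^ n / real n) has_real_derivative t ^ (n - 1)) (at t)"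
  by (rule derivative_eq_intros refl | simp)+

text \<open>Multiplying \<open>- y' - p * y\<close> by the integrating factor \<open>exp (- P)\<close>, where \<open>P' = p\<close>, turns
  the claim into a sign statement for a function with derivative \<open>(lam - p') * y * exp (- P)\<close>.\<close>
lemma ground_state_log_derivative_ge:
  fixes m :: nat and y y' :: "real \<Rightarrow> real"
  assumes m: "m \<ge> 1"
    and y: "\<And>t. (y has_real_derivative y' t) (at t)"
    and y': "\<And>t. (y' has_real_derivative ((t ^ m / real m)\<^sup>2 - lam) * y t) (at t)"
    and pos: "\<And>t. y t > 0" and dec: "\<And>t. 0 \<le> t \<Longrightarrow> y' t \<le> 0" and y'0: "y' 0 = 0"
    and t1: "0 \<le> t1"
  shows "t1 ^ m / real m * y t1 \<le> - y' t1"
proof (rule ccontr)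
  assume contra: "\<not> ?thesis"
  define P where "P = (\<lambda>t. t ^ (m + 1) / (real m * real (m + 1)))"
  define D where "D = (\<lambda>t. (- y' t - t ^ m / real m * y t) * exp (- P t))"
  have m0: "real m > 0" using m by simp
  have P: "(P has_real_derivative t ^ m / real m) (at t)" for t
    using DERIV_cdivide[OF power_over_exponent[of "m + 1" t], where c = "real m"]
    by (simp add: P_def mult.commute)
  have p: "((\<lambda>t. t ^ m / real m) has_real_derivative t ^ (m - 1)) (at t)" for t
    by (rule power_over_exponent[OF m])
  have D: "(D has_real_derivative (lam - t ^ (m - 1)) * y t * exp (- P t)) (at t)" for t
    unfolding D_def
    by (rule derivative_eq_intros y y' p P refl)+ (simp add: algebra_simps power2_eq_square)
  define \<delta> where "\<delta> = - D t1"
  have \<delta>: "\<delta> > 0" using contra by (simp add: \<delta>_def D_def mult_less_0_iff)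
  have D0: "D 0 = 0" using m y'0 by (simp add: D_def)
  have "t1 \<noteq> 0" using \<delta> D0 by (auto simp: \<delta>_def)
  with t1 have "t1 > 0" by simp
  \<comment> \<open>\<open>D\<close> falls from 0 to \<open>- \<delta>\<close>, so its derivative is
    negative at some \<xi> before \<open>t1\<close>, that is \<open>lam < \<xi> ^ (m - 1)\<close>.
    The power is monotone, so \<open>D\<close> keeps decreasing after \<open>t1\<close> and never
    returns above \<open>- \<delta>\<close>.\<close>
  from MVT2[OF this D] obtain \<xi> where \<xi>: "0 < \<xi>" "\<xi> < t1"
    "D t1 - D 0 = (t1 - 0) * ((lam - \<xi> ^ (m - 1)) * y \<xi> * exp (- P \<xi>))" by blast
  have neg: "lam < \<xi> ^ (m - 1)"
  proof (rule ccontr)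
    assume "\<not> lam < \<xi> ^ (m - 1)"
    hence "0 \<le> (t1 - 0) * ((lam - \<xi> ^ (m - 1)) * y \<xi> * exp (- P \<xi>))"
      using t1 pos[of \<xi>] by (intro mult_nonneg_nonneg) auto
    thus False using \<xi>(3) \<delta> D0 by (simp add: \<delta>_def)
  qed
  \<comment> \<open>At this \<open>t\<close> the bound
    \<open>\<delta> * exp (P t) \<le> t ^ m / m * y 0\<close> fails: already
    \<open>exp (P t) \<ge> P t\<close>, and \<open>P t\<close> is \<open>t / (m + 1)\<close> times
    \<open>t ^ m / m\<close>.\<close>
  define t where "t = max t1 ((real m + 1) * y 0 / \<delta> + 1)"
  have t: "t1 \<le> t" "(real m + 1) * y 0 / \<delta> < t" "0 < t" using \<open>t1 > 0\<close> by (auto simp: t_def)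
  have "D t \<le> D t1"
  proof (rule DERIV_nonpos_imp_nonincreasing[OF t(1)])
    fix s assume s: "t1 \<le> s" "s \<le> t"
    have "\<xi> ^ (m - 1) \<le> s ^ (m - 1)" using \<xi> s by (intro power_mono) auto
    hence "(lam - s ^ (m - 1)) * y s * exp (- P s) \<le> 0"
      using neg pos[of s] by (intro mult_nonpos_nonneg) auto
    thus "\<exists>d. (D has_real_derivative d) (at s) \<and> d \<le> 0" using D by blast
  qed
  hence "D t * exp (P t) \<le> - \<delta> * exp (P t)" by (intro mult_right_mono) (auto simp: \<delta>_def)
  hence "\<delta> * exp (P t) \<le> t ^ m / real m * y t + y' t"
    by (simp add: D_def mult.assoc flip: exp_add)
  also have "\<dots> \<le> t ^ m / real m * y t" using dec[of t] t by simp
  also have "\<dots> \<le> t ^ m / real m * y 0"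
  proof (intro mult_left_mono)
    show "y t \<le> y 0"
      by (rule DERIV_nonpos_imp_nonincreasing[of 0 t y]) (use t y dec in auto)
  qed (use t in auto)
  finally have up: "\<delta> * exp (P t) \<le> t ^ m / real m * y 0" .
  define q where "q = t ^ m / real m"
  have q: "q > 0" using t m0 by (simp add: q_def)
  have Pq: "P t = t * q / (real m + 1)" by (simp add: P_def q_def)
  have "\<delta> * P t \<le> \<delta> * exp (P t)" using \<delta> exp_ge_add_one_self[of "P t"] by (intro mult_left_mono) linarith+
  hence "(\<delta> * t / (real m + 1)) * q \<le> y 0 * q" using up by (simp add: Pq q_def mult_ac)
  hence "\<delta> * t / (real m + 1) \<le> y 0" using q by (rule mult_right_le_imp_le)
  hence "t \<le> (real m + 1) * y 0 / \<delta>" using \<delta> by (simp add: field_simps)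
  thus False using t by simp
qed

section \<open>The linearised equation for the logarithmic derivative\<close>

definition tail :: "(real \<Rightarrow> real) \<Rightarrow> real \<Rightarrow> real" where
  "tail g t = (LINT x|lborel. indicator {t..} x * g x)"

lemma integrable_indicator_times:
  fixes g :: "real \<Rightarrow> real"
  shows "integrable lborel g \<Longrightarrow> S \<in> sets borel \<Longrightarrow> integrable lborel (\<lambda>x. indicator S x * g x)"
  using integrable_mult_indicator[of S lborel g] by simp

text \<open>The overlap in the point \<open>t\<close> is a null set; allowing it lets closed
  intervals be glued.\<close>

lemma tail_split:
  fixes g :: "real \<Rightarrow> real"
  assumes g: "integrable lborel g" and S: "S \<in> sets borel" "S \<inter> {t..} \<subseteq> {t}"
  shows "(LINT x|lborel. indicator (S \<union> {t..}) x * g x) = (LINT x|lborel. indicator S x * g x) + tail g t"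
proof -
  have int: "integrable lborel (\<lambda>x. indicator A x * g x)" if "A \<in> sets borel" for A
    by (rule integrable_indicator_times[OF g that])
  have "(LINT x|lborel. indicator (S \<union> {t..}) x * g x) =
      (LINT x|lborel. indicator S x * g x + indicator {t..} x * g x)"
  proof (rule integral_cong_AE)
    show "AE x in lborel. indicator (S \<union> {t..}) x * g x = indicator S x * g x + indicator {t..} x * g x"
      using AE_lborel_singleton[of t]
      by eventually_elim (use S(2) in \<open>auto simp: indicator_def\<close>)
  qed (use S(1) in \<open>intro borel_measurable_integrable int Bochner_Integration.integrable_add; simp\<close>)+
  also have "\<dots> = (LINT x|lborel. indicator S x * g x) + tail g t"
    unfolding tail_def by (intro Bochner_Integration.integral_add int S(1)) auto
  finally show ?thesis .
qed

lemma tail_has_derivative: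
  fixes g :: "real \<Rightarrow> real"
  assumes g: "integrable lborel g" and cont: "continuous_on UNIV g"
  shows "(tail g has_real_derivative - g t) (at t)"
proof -
  define a where "a = t - 1"
  have eq: "tail g s = tail g a - integral {a..s} g" if s: "a \<le> s" for s
  proof -
    have "{a..s} \<union> {s..} = {a..}" using s by auto
    moreover have "{a..s} \<inter> {s..} \<subseteq> {s}" by auto
    ultimately have "tail g a = (LINT x|lborel. indicator {a..s} x * g x) + tail g s"
      using tail_split[OF g _ \<open>{a..s} \<inter> {s..} \<subseteq> {s}\<close>] by (simp add: tail_def)
    also have "(LINT x|lborel. indicator {a..s} x * g x) = integral {a..s} g"
      using set_borel_integral_eq_integral(2)[of "{a..s}" g] integrable_indicator_times[OF g, of "{a..s}"]
      by (simp add: set_integrable_def set_lebesgue_integral_def)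
    finally show ?thesis by simp
  qed
  have "((\<lambda>s. integral {a..s} g) has_real_derivative g t) (at t within {a..t + 1})"
    by (rule integral_has_real_derivative) (auto simp: a_def intro: continuous_on_subset[OF cont])
  hence "((\<lambda>s. integral {a..s} g) has_real_derivative g t) (at t)"
    by (simp add: a_def at_within_Icc_at)
  hence "((\<lambda>s. tail g a - integral {a..s} g) has_real_derivative 0 - g t) (at t)"
    by (intro DERIV_diff DERIV_const)
  hence "((\<lambda>s. tail g a - integral {a..s} g) has_real_derivative - g t) (at t)" by simp
  thus ?thesis
  proof (rule has_field_derivative_transform_within_open)
    show "open {a<..}" "t \<in> {a<..}" by (auto simp: a_def)
    show "tail g a - integral {a..s} g = tail g s" if "s \<in> {a<..}" for s
      using that by (intro eq[symmetric]) simp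
  qed
qed

lemma tail_tendsto_0:
  fixes g :: "real \<Rightarrow> real"
  assumes g: "integrable lborel g"
  shows "(tail g \<longlongrightarrow> 0) at_top"
proof -
  have "tail g t = (LINT x|lborel. g x) - (LINT x|lborel. indicator {..t} x * g x)" for t
  proof -
    have "{..t} \<union> {t..} = (UNIV :: real set)" by auto
    moreover have "{..t} \<inter> {t..} \<subseteq> {t}" by auto
    ultimately show ?thesis using tail_split[OF g, of "{..t}" t] by simp
  qed
  hence "tail g = (\<lambda>t. (LINT x|lborel. g x) - (LINT x|lborel. indicator {..t} x * g x))"
    by (rule ext)
  moreover have "((\<lambda>t. (LINT x|lborel. g x) - (LINT x|lborel. indicator {..t} x * g x)) \<longlongrightarrow>
      (LINT x|lborel. g x) - (LINT x|lborel. g x)) at_top"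
    using tendsto_integral_at_top[of lborel g] g by (intro tendsto_diff tendsto_const) simp
  ultimately show ?thesis by simp
qed

lemma tail_uminus_tendsto:
  fixes g :: "real \<Rightarrow> real"
  assumes g: "integrable lborel g"
  shows "((\<lambda>t. tail g (- t)) \<longlongrightarrow> (LINT x|lborel. g x)) at_top"
proof -
  have r: "integrable lborel (\<lambda>x. g (- x))"
    using lborel_integrable_real_affine[OF g, of "-1" 0] by simp
  have "tail g (- t) = (LINT x|lborel. indicator {..t} x * g (- x))" for t
  proof -
    have "indicator {- t..} (- x) = (indicator {..t} x :: real)" for x by (auto simp: indicator_def)
    thus ?thesis
      unfolding tail_def by (subst lborel_integral_real_affine[where c = "-1" and t = 0]) auto
  qed
  moreover have "(LINT x|lborel. g x) = (LINT x|lborel. g (- x))"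
    by (subst lborel_integral_real_affine[where c = "-1" and t = 0]) auto
  ultimately show ?thesis using tendsto_integral_at_top[of lborel "\<lambda>x. g (- x)"] r by simp
qed

text \<open>Every tail lies between 0 and the whole integral. If the latter were not positive, all
  tails would vanish, and so would their derivative \<open>- g\<close>.\<close>

lemma integral_pos_if_continuous:
  fixes g :: "real \<Rightarrow> real"
  assumes g: "integrable lborel g" and cont: "continuous_on UNIV g"
    and nonneg: "\<And>t. 0 \<le> g t" and pos: "0 < g s"
  shows "0 < (LINT x|lborel. g x)"
proof (rule ccontr)
  assume *: "\<not> 0 < (LINT x|lborel. g x)"
  have "tail g t = 0" for t
  proof (rule antisym)
    have "tail g t \<le> (LINT x|lborel. g x)" unfolding tail_def
      by (intro integral_mono integrable_indicator_times g) (auto simp: indicator_def nonneg)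
    thus "tail g t \<le> 0" using * by simp
    show "0 \<le> tail g t" unfolding tail_def
      by (intro Bochner_Integration.integral_nonneg) (simp add: nonneg)
  qed
  hence "tail g = (\<lambda>_. 0)" by auto
  with tail_has_derivative[OF g cont, of s] have "((\<lambda>_. 0) has_real_derivative - g s) (at s)"
    by simp
  from DERIV_unique[OF this DERIV_const] pos show False by simp
qed

text \<open>For \<open>c = 1\<close> and \<open>c = - 1\<close> the function
  \<open>w - c * h\<close> is nonincreasing. Since \<open>w\<close> is nonnegative,
  \<open>w t - c * h t \<ge> - c * h s\<close> for all later \<open>s\<close>, and the right side
  tends to 0.\<close>

lemma dominated_by_decreasing:
  fixes h g w w' :: "real \<Rightarrow> real"
  assumes h: "\<And>t. a \<le> t \<Longrightarrow> (h has_real_derivative g t) (at t)"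
    and w: "\<And>t. a \<le> t \<Longrightarrow> (w has_real_derivative w' t) (at t)"
    and le: "\<And>t. a \<le> t \<Longrightarrow> \<bar>g t\<bar> \<le> - w' t" and nonneg: "\<And>t. 0 \<le> w t"
    and lim: "(h \<longlongrightarrow> 0) at_top" and t: "a \<le> t"
  shows "\<bar>h t\<bar> \<le> w t"
proof -
  have *: "c * h t \<le> w t" if c: "\<bar>c\<bar> = 1" for c
  proof -
    have "c * h t - w t \<le> c * h s" if s: "t \<le> s" for s
    proof -
      have "w s - c * h s \<le> w t - c * h t"
      proof (rule DERIV_nonpos_imp_nonincreasing[OF s])
        fix x assume x: "t \<le> x" "x \<le> s"
        have "- (c * g x) \<le> \<bar>g x\<bar>"
          using c by (metis abs_ge_minus_self abs_mult mult_1)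
        hence "w' x - c * g x \<le> 0" using le[of x] x t by linarith
        thus "\<exists>d. ((\<lambda>s. w s - c * h s) has_real_derivative d) (at x) \<and> d \<le> 0"
          using x t by (intro exI[of _ "w' x - c * g x"] conjI DERIV_diff DERIV_cmult w h) auto
      qed
      thus ?thesis using nonneg[of s] by linarith
    qed
    hence "eventually (\<lambda>s. c * h t - w t \<le> c * h s) at_top"
      using eventually_ge_at_top[of t] by (rule eventually_mono[rotated])
    moreover have "((\<lambda>s. c * h s) \<longlongrightarrow> c * 0) at_top" by (intro tendsto_intros lim)
    ultimately have "c * h t - w t \<le> c * 0" by (intro tendsto_lowerbound) auto
    thus ?thesis by simp
  qed
  from *[of 1] *[of "-1"] show ?thesis by simp
qed

text \<open>Because \<open>g\<close> has integral zero, its tail vanishes at both ends of the line.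
  Negative \<open>t\<close> are reflected to positive ones, the comparison function being
  even.\<close>

lemma tail_dominated:
  fixes g w w' :: "real \<Rightarrow> real"
  assumes g: "integrable lborel g" "continuous_on UNIV g" "(LINT x|lborel. g x) = 0"
    and w: "\<And>t. (w has_real_derivative w' t) (at t)" "\<And>t. w (- t) = w t" "\<And>t. 0 \<le> w t"
    and le: "\<And>t. a \<le> t \<Longrightarrow> \<bar>g t\<bar> \<le> - w' t" "\<And>t. a \<le> t \<Longrightarrow> \<bar>g (- t)\<bar> \<le> - w' t"
    and t: "a \<le> \<bar>t\<bar>"
  shows "\<bar>tail g t\<bar> \<le> w t"
proof (cases "0 \<le> t")
  case True
  show ?thesis
    by (rule dominated_by_decreasing[OF tail_has_derivative[OF g(1,2)] w(1) _ w(3) tail_tendsto_0[OF g(1)], where a = a])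
      (use le True t in auto)
next
  case False
  have "\<bar>tail g (- \<bar>t\<bar>)\<bar> \<le> w \<bar>t\<bar>"
  proof (rule dominated_by_decreasing[OF _ w(1) _ w(3), where a = a])
    show "((\<lambda>t. tail g (- t)) has_real_derivative g (- s)) (at s)" for s
      using DERIV_chain2[OF tail_has_derivative[OF g(1,2)] DERIV_minus[OF DERIV_ident], of s] by simp
    show "((\<lambda>t. tail g (- t)) \<longlongrightarrow> 0) at_top" using tail_uminus_tendsto[OF g(1)] g(3) by simp
  qed (use le t in auto)
  moreover have "\<bar>t\<bar> = - t" using False by simp
  ultimately show ?thesis by (simp add: w(2))
qed

text \<open>Serves the unperturbed and the perturbed ground state alike; the margin 1/2 is the room
  left for the perturbation of the logarithmic derivative. Beyond \<open>a\<close> one has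
  \<open>p \<ge> 2 + \<bar>mu\<bar>\<close>, which turns the hypotheses into exponential decay and
  makes \<open>\<bar>p - \<alpha>\<bar> \<ge> 1 + \<bar>mu\<bar>\<close>, so the potential exceeds
  \<open>mu\<close>.\<close>

lemma ground_state_square_integrable:
  fixes u u' :: "real \<Rightarrow> real"
  assumes k: "even k" and \<alpha>: "\<bar>\<alpha>\<bar> \<le> 1"
    and pos: "\<And>t. u t > 0"
    and u: "\<And>t. (u has_real_derivative u' t) (at t)"
    and u': "\<And>t. (u' has_real_derivative (Qpot k \<alpha> t - mu) * u t) (at t)"
    and right: "\<And>t. 0 \<le> t \<Longrightarrow> u' t \<le> (1/2 - t ^ (k + 1) / real (k + 1)) * u t"
    and left: "\<And>t. t \<le> 0 \<Longrightarrow> (- 1/2 - t ^ (k + 1) / real (k + 1)) * u t \<le> u' t"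
  shows "integrable lborel (\<lambda>t. (u t)\<^sup>2)"
    and "integrable lborel (\<lambda>t. (u' t)\<^sup>2)"
    and "integrable lborel (\<lambda>t. Qpot k \<alpha> t * (u t)\<^sup>2)"
proof -
  define p where "p = (\<lambda>t::real. t ^ (k + 1) / real (k + 1))"
  define a where "a = real (k + 1) * (2 + \<bar>mu\<bar>)"
  have a: "1 \<le> a" unfolding a_def
    using mult_mono[of 1 "real (k + 1)" 1 "2 + \<bar>mu\<bar>"] by simp
  have p_large: "2 + \<bar>mu\<bar> \<le> p t" if t: "a \<le> t" for t
  proof -
    have "t ^ 1 \<le> t ^ (k + 1)" using a t by (intro power_increasing) auto
    thus ?thesis using t by (simp add: p_def a_def field_simps)
  qed
  have p_odd: "p (- t) = - p t" for t using k by (simp add: p_def)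
  have square: "mu \<le> x\<^sup>2" if "1 + \<bar>mu\<bar> \<le> \<bar>x\<bar>" for x
  proof -
    have "1 + \<bar>mu\<bar> \<le> (1 + \<bar>mu\<bar>)\<^sup>2" by (simp add: power2_eq_square algebra_simps)
    also have "\<dots> \<le> x\<^sup>2" using that by (simp add: abs_le_square_iff[symmetric])
    finally show ?thesis by linarith
  qed
  have V: "continuous_on UNIV (Qpot k \<alpha>)" unfolding Qpot_def by (intro continuous_intros) auto
  have 1: "u' t \<le> - u t / 2" if t: "a \<le> t" for t
  proof -
    have "(1/2 - p t) * u t \<le> (- 1/2) * u t"
      using p_large[OF t] pos[of t] by (intro mult_right_mono) auto
    thus ?thesis using right[of t] t a by (simp add: p_def)
  qed
  have 2: "mu \<le> Qpot k \<alpha> t" if t: "a \<le> t" for t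
    using p_large[OF t] \<alpha> unfolding Qpot_def p_def by (intro square) linarith
  have 3: "u t / 2 \<le> u' t" if t: "t \<le> - a" for t
  proof -
    have "(1/2) * u t \<le> (- 1/2 - p t) * u t"
      using p_large[of "- t"] p_odd[of t] t pos[of t] by (intro mult_right_mono) auto
    moreover have "(- 1/2 - p t) * u t \<le> u' t" using left[of t] t a by (simp add: p_def)
    ultimately show ?thesis by linarith
  qed
  have 4: "mu \<le> Qpot k \<alpha> t" if t: "t \<le> - a" for t
    using p_large[of "- t"] p_odd[of t] t \<alpha> unfolding Qpot_def p_def by (intro square) linarith
  note int = decay_imp_square_integrable[OF pos u u' V 1 2 3 4]
  show "integrable lborel (\<lambda>t. (u t)\<^sup>2)" "integrable lborel (\<lambda>t. (u' t)\<^sup>2)"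
    "integrable lborel (\<lambda>t. Qpot k \<alpha> t * (u t)\<^sup>2)"
    using int by auto
qed

section \<open>The ground state at parameter 0, its weight \<open>rho\<close>, and the solution
  operator \<open>L\<close>\<close>

locale ground_state =
  fixes k :: nat and lam :: real and y y' :: "real \<Rightarrow> real"
  assumes k: "even k" "k \<ge> 2" and lam_pos: "lam > 0"
    and y: "\<And>t. (y has_real_derivative y' t) (at t)"
    and y': "\<And>t. (y' has_real_derivative ((t ^ (k + 1) / real (k + 1))\<^sup>2 - lam) * y t) (at t)"
    and y_pos: "\<And>t. y t > 0"
    and y_even: "\<And>t. y (- t) = y t" and y'_odd: "\<And>t. y' (- t) = - y' t"
    and log_derivative_ge: "\<And>t. 0 \<le> t \<Longrightarrow> t ^ (k + 1) / real (k + 1) * y t \<le> - y' t"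
begin

definition p :: "real \<Rightarrow> real" where "p t = t ^ (k + 1) / real (k + 1)"
definition q :: "real \<Rightarrow> real" where "q t = - y' t / y t"
definition rho :: "real \<Rightarrow> real" where "rho t = (y t)\<^sup>2"
definition avg :: "(real \<Rightarrow> real) \<Rightarrow> real" where
  "avg f = (LINT x|lborel. rho x * f x) / (LINT x|lborel. rho x)"

text \<open>The bounded solution \<open>v\<close> of \<open>v' = 2 q v + f - avg f\<close>; subtracting the average makes the
  tail integral vanish at both ends.\<close>
definition L :: "(real \<Rightarrow> real) \<Rightarrow> real \<Rightarrow> real" where
  "L f t = - tail (\<lambda>x. rho x * (f x - avg f)) t / rho t"

text \<open>This is \<open>L\<close> at \<open>2 * p\<close>, whose average is zero by oddness. It
  is kept apart because \<open>p\<close> is unbounded, while the estimates for \<open>L\<close>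
  concern bounded functions.\<close>

definition v0 :: "real \<Rightarrow> real" where "v0 t = - 2 * tail (\<lambda>x. rho x * p x) t / rho t"

lemma y_ne[simp]: "y t \<noteq> 0" using y_pos[of t] by simp
lemma rho_pos: "rho t > 0" by (simp add: rho_def)
lemma rho_ne[simp]: "rho t \<noteq> 0" using rho_pos[of t] by simp
lemma rho_even: "rho (- t) = rho t" by (simp add: rho_def y_even)

lemma p_odd: "p (- t) = - p t" using k by (simp add: p_def)
lemma p_deriv: "(p has_real_derivative t ^ k) (at t)"
  using power_over_exponent[of "k + 1" t] by (simp add: p_def[abs_def])
lemma p_nonneg: "0 \<le> t \<Longrightarrow> 0 \<le> p t" by (simp add: p_def)

lemma rho_deriv: "(rho has_real_derivative 2 * (y t * y' t)) (at t)"
  unfolding rho_def by (rule derivative_eq_intros y refl)+ simp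

lemma q_deriv: "(q has_real_derivative lam - (p t)\<^sup>2 + (q t)\<^sup>2) (at t)"
proof -
  have "((\<lambda>t. - (y' t / y t)) has_real_derivative
      - ((((p t)\<^sup>2 - lam) * y t * y t - y' t * y' t) / (y t * y t))) (at t)"
    using y' unfolding p_def by (intro DERIV_minus DERIV_divide y y_ne)
  moreover have "- ((((p t)\<^sup>2 - lam) * y t * y t - y' t * y' t) / (y t * y t)) = lam - (p t)\<^sup>2 + (q t)\<^sup>2"
    by (simp add: q_def diff_divide_distrib power2_eq_square)
  ultimately show ?thesis by (simp add: q_def[abs_def])
qed

lemma cont: "continuous_on S y" "continuous_on S y'" "continuous_on S p" "continuous_on S q" "continuous_on S rho"
  by (intro continuous_at_imp_continuous_on ballI DERIV_isCont[OF y] DERIV_isCont[OF y']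
      DERIV_isCont[OF p_deriv] DERIV_isCont[OF q_deriv] DERIV_isCont[OF rho_deriv])+

lemma integrable_rho: "integrable lborel rho"
  and integrable_p2_rho: "integrable lborel (\<lambda>t. (p t)\<^sup>2 * rho t)"
proof -
  have Q: "Qpot k 0 t = (p t)\<^sup>2" for t by (simp add: Qpot_def p_def)
  have 1: "(y' has_real_derivative (Qpot k 0 t - lam) * y t) (at t)" for t
    using y' by (simp add: Qpot_def)
  have 2: "y' t \<le> (1/2 - t ^ (k + 1) / real (k + 1)) * y t" if "0 \<le> t" for t
    using log_derivative_ge[OF that] y_pos[of t] unfolding left_diff_distrib by linarith
  have 3: "(- 1/2 - t ^ (k + 1) / real (k + 1)) * y t \<le> y' t" if t: "t \<le> 0" for t
  proof -
    have "- y' t \<le> (1/2 + p t) * y t"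
      using 2[of "- t"] t unfolding p_def[symmetric] p_odd y_even y'_odd by simp
    moreover have "(- 1/2 - p t) * y t = - ((1/2 + p t) * y t)" by (simp add: algebra_simps)
    ultimately show ?thesis unfolding p_def[symmetric] by linarith
  qed
  note int = ground_state_square_integrable[OF k(1) _ y_pos y 1 2 3]
  show "integrable lborel rho" using int(1) by (simp add: rho_def[abs_def])
  show "integrable lborel (\<lambda>t. (p t)\<^sup>2 * rho t)" using int(3) by (simp add: rho_def Q)
qed

lemma integrable_p_rho: "integrable lborel (\<lambda>t. rho t * p t)"
proof (rule Bochner_Integration.integrable_bound[OF Bochner_Integration.integrable_add[OF integrable_rho integrable_p2_rho]])
  show "(\<lambda>t. rho t * p t) \<in> borel_measurable lborel"
    using borel_measurable_continuous_onI[OF cont(3)] borel_measurable_continuous_onI[OF cont(5)] by simp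
  show "AE t in lborel. norm (rho t * p t) \<le> norm (rho t + (p t)\<^sup>2 * rho t)"
  proof (rule AE_I2)
    fix t
    have "\<bar>p t\<bar> \<le> 1 + (p t)\<^sup>2"
      using sum_squares_bound[of 1 "\<bar>p t\<bar>"] zero_le_power2[of "p t"] by (simp del: zero_le_power2)
    hence "rho t * \<bar>p t\<bar> \<le> rho t * (1 + (p t)\<^sup>2)"
      using rho_pos[of t] by (intro mult_left_mono) auto
    also have "\<dots> = rho t + (p t)\<^sup>2 * rho t" by (simp add: distrib_left mult.commute)
    finally have "rho t * \<bar>p t\<bar> \<le> rho t + (p t)\<^sup>2 * rho t" .
    moreover have "norm (rho t * p t) = rho t * \<bar>p t\<bar>" using rho_pos[of t] by (simp add: abs_mult)
    ultimately show "norm (rho t * p t) \<le> norm (rho t + (p t)\<^sup>2 * rho t)"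
      unfolding real_norm_def by linarith
  qed
qed

lemma integral_p_rho: "(LINT t|lborel. rho t * p t) = 0"
proof -
  have "(LINT t|lborel. rho t * p t) = (LINT t|lborel. rho (- t) * p (- t))"
    by (subst lborel_integral_real_affine[where c = "-1" and t = 0]) auto
  also have "\<dots> = - (LINT t|lborel. rho t * p t)" by (simp add: rho_even p_odd)
  finally show ?thesis by linarith
qed

lemma mass_pos: "(LINT x|lborel. rho x) > 0"
  by (rule integral_pos_if_continuous[OF integrable_rho cont(5) _ rho_pos[of 0]])
    (simp add: rho_pos less_imp_le)

text \<open>Since \<open>rho' = - 2 * q * rho\<close>, dividing by \<open>rho\<close> converts the
  derivative of a tail integral into the linear equation with coefficient
  \<open>2 * q\<close>.\<close>

lemma divide_rho_deriv:
  assumes "(h has_real_derivative D) (at t)"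
  shows "((\<lambda>t. h t / rho t) has_real_derivative D / rho t + 2 * q t * (h t / rho t)) (at t)"
proof -
  have "(D * rho t - h t * (2 * (y t * y' t))) / (rho t * rho t) = D / rho t + 2 * q t * (h t / rho t)"
    by (simp add: q_def rho_def field_simps power2_eq_square)
  thus ?thesis using DERIV_divide[OF assms rho_deriv rho_ne] by simp
qed

lemma v0_deriv: "(v0 has_real_derivative 2 * q t * v0 t + 2 * p t) (at t)"
proof -
  have "((\<lambda>t. - 2 * tail (\<lambda>x. rho x * p x) t) has_real_derivative - 2 * - (rho t * p t)) (at t)"
    by (intro DERIV_cmult tail_has_derivative integrable_p_rho continuous_intros cont)
  from divide_rho_deriv[OF this] show ?thesis by (simp add: v0_def[abs_def])
qed

text \<open>On the positive half line \<open>log_derivative_ge\<close> reads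
  \<open>rho * p \<le> - (rho / 2)'\<close>, so \<open>rho / 2\<close> dominates the tail of
  \<open>rho * p\<close>.\<close>

lemma v0_bound: "\<bar>v0 t\<bar> \<le> 1"
proof -
  have "\<bar>tail (\<lambda>x. rho x * p x) t\<bar> \<le> rho t / 2"
  proof (rule tail_dominated[OF integrable_p_rho continuous_on_mult[OF cont(5) cont(3)] integral_p_rho, where a = 0])
    show "((\<lambda>t. rho t / 2) has_real_derivative y t * y' t) (at t)" for t
      using DERIV_cdivide[OF rho_deriv[of t], of 2] by simp
    have *: "rho t * p t \<le> - (y t * y' t)" if "0 \<le> t" for t
      using mult_left_mono[OF log_derivative_ge[OF that], of "y t"] y_pos[of t]
      by (simp add: rho_def p_def power2_eq_square mult_ac)
    show "\<bar>rho t * p t\<bar> \<le> - (y t * y' t)" if "0 \<le> t" for t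
      using *[OF that] p_nonneg[OF that] rho_pos[of t] by (simp add: abs_mult)
    thus "\<bar>rho (- t) * p (- t)\<bar> \<le> - (y t * y' t)" if "0 \<le> t" for t
      using that by (simp add: rho_even p_odd)
  qed (use rho_pos in \<open>auto simp: rho_even intro: less_imp_le\<close>)
  thus ?thesis using rho_pos[of t] by (simp add: v0_def abs_mult field_simps)
qed

lemma integrable_rho_bounded:
  assumes "continuous_on UNIV f" "\<And>t. \<bar>f t\<bar> \<le> B"
  shows "integrable lborel (\<lambda>t. rho t * f t)"
proof (rule Bochner_Integration.integrable_bound[OF integrable_mult_right[OF integrable_rho, of B]])
  show "(\<lambda>t. rho t * f t) \<in> borel_measurable lborel"
    using borel_measurable_continuous_onI[OF cont(5)] borel_measurable_continuous_onI[OF assms(1)] by simp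
  have "0 \<le> B" using assms(2)[of 0] by linarith
  thus "AE t in lborel. norm (rho t * f t) \<le> norm (B * rho t)"
    using mult_left_mono[OF assms(2), of "rho _"] rho_pos
    by (intro AE_I2) (simp add: abs_mult less_imp_le mult.commute)
qed

lemma avg_le:
  assumes f: "continuous_on UNIV f" "\<And>t. \<bar>f t\<bar> \<le> B"
  shows "\<bar>avg f\<bar> \<le> B"
proof -
  have "\<bar>LINT x|lborel. rho x * f x\<bar> \<le> (LINT x|lborel. \<bar>rho x * f x\<bar>)" by (rule integral_abs_bound)
  also have "\<dots> \<le> (LINT x|lborel. B * rho x)"
    using mult_left_mono[OF f(2), of "rho _"] rho_pos
    by (intro integral_mono integrable_abs integrable_rho_bounded[OF f] integrable_mult_right integrable_rho)
      (simp add: abs_mult less_imp_le mult.commute)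
  also have "\<dots> = B * (LINT x|lborel. rho x)" by simp
  finally show ?thesis using mass_pos by (simp add: avg_def field_simps)
qed

text \<open>If \<open>v0^2\<close> were 1 everywhere, \<open>v0\<close> would be constant and its
  equation would make \<open>q\<close> a multiple of \<open>p\<close>, hence \<open>q' = 0\<close>
  at 0. The Riccati equation gives the value \<open>lam > 0\<close> instead. So
  \<open>v0^2 < 1\<close> somewhere, and continuity makes the average strictly smaller than
  1.\<close>

lemma avg_v0_square_less_1: "avg (\<lambda>t. (v0 t)\<^sup>2) < 1"
proof -
  have cv: "continuous_on UNIV v0"
    by (intro continuous_at_imp_continuous_on ballI DERIV_isCont[OF v0_deriv])
  have sq: "(v0 t)\<^sup>2 \<le> 1" for t using v0_bound[of t] by (simp add: abs_square_le_1)
  obtain t0 where t0: "(v0 t0)\<^sup>2 < 1"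
  proof (rule ccontr)
    assume "\<not> thesis"
    hence one: "(v0 t)\<^sup>2 = 1" for t using that[of t] sq[of t] by (cases "(v0 t)\<^sup>2 < 1") auto
    have const: "(\<lambda>t. (v0 t)\<^sup>2) = (\<lambda>_. 1)" using one by auto
    have ne: "v0 t \<noteq> 0" for t using one[of t] by auto
    have "2 * v0 t * (2 * q t * v0 t + 2 * p t) = 0" for t
    proof (rule DERIV_unique)
      show "((\<lambda>t. (v0 t)\<^sup>2) has_real_derivative 2 * v0 t * (2 * q t * v0 t + 2 * p t)) (at t)"
        by (rule derivative_eq_intros v0_deriv refl)+ simp
    qed (simp add: const)
    hence zero: "2 * q t * v0 t + 2 * p t = 0" for t using ne by simp
    hence "\<forall>t. (v0 has_real_derivative 0) (at t)" using v0_deriv by metis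
    hence v0c: "v0 t = v0 0" for t by (rule DERIV_isconst_all)
    have "q t = - p t / v0 0" for t
      using zero[of t] v0c[of t] ne[of 0] by (simp add: field_simps)
    hence "q = (\<lambda>t. - p t / v0 0)" by auto
    moreover have "((\<lambda>t. - p t / v0 0) has_real_derivative - (0 ^ k) / v0 0) (at 0)"
      by (intro DERIV_cdivide DERIV_minus p_deriv)
    ultimately have "lam - (p 0)\<^sup>2 + (q 0)\<^sup>2 = - (0 ^ k) / v0 0"
      using DERIV_unique[OF q_deriv[of 0]] by simp
    moreover have "p 0 = 0" "q 0 = 0" using y'_odd[of 0] by (simp_all add: p_def q_def)
    moreover have "(0::real) ^ k = 0" using k by simp
    ultimately show False using lam_pos by simp
  qed
  have int: "integrable lborel (\<lambda>t. rho t * (v0 t)\<^sup>2)"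
    by (rule integrable_rho_bounded[where B = 1]) (use cv sq in \<open>auto intro!: continuous_intros\<close>)
  have "0 < (LINT t|lborel. rho t - rho t * (v0 t)\<^sup>2)"
  proof (rule integral_pos_if_continuous[where s = t0])
    show "integrable lborel (\<lambda>t. rho t - rho t * (v0 t)\<^sup>2)"
      by (intro Bochner_Integration.integrable_diff integrable_rho int)
    show "continuous_on UNIV (\<lambda>t. rho t - rho t * (v0 t)\<^sup>2)"
      by (intro continuous_intros cont cv)
    show "0 \<le> rho t - rho t * (v0 t)\<^sup>2" for t
      using mult_left_mono[OF sq[of t], of "rho t"] rho_pos[of t] by simp
    show "0 < rho t0 - rho t0 * (v0 t0)\<^sup>2"
      using mult_strict_left_mono[OF t0 rho_pos[of t0]] by simp
  qed
  hence "(LINT t|lborel. rho t * (v0 t)\<^sup>2) < (LINT t|lborel. rho t)"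
    using integrable_rho int by simp
  thus ?thesis using mass_pos by (simp add: avg_def)
qed

text \<open>For \<open>t \<ge> k + 1\<close> one has \<open>p t \<ge> 1\<close>, hence
  \<open>rho \<le> - rho'\<close>, and \<open>B * rho\<close> itself dominates the tail on both
  sides. On the remaining compact interval the crude bound \<open>B * M\<close> suffices, because
  \<open>rho\<close> is bounded below there by \<open>rho s\<close>.\<close>

lemma tail_bound_exists: "\<exists>K. \<forall>g B t. continuous_on UNIV g \<longrightarrow> (LINT x|lborel. g x) = 0 \<longrightarrow>
    (\<forall>t. \<bar>g t\<bar> \<le> B * rho t) \<longrightarrow> \<bar>tail g t\<bar> \<le> K * B * rho t"
proof -
  define a where "a = real (k + 1)"
  have "\<exists>s\<in>{-a..a}. \<forall>t\<in>{-a..a}. rho s \<le> rho t"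
    by (rule continuous_attains_inf) (auto simp: a_def cont)
  then obtain s where s': "\<forall>t\<in>{-a..a}. rho s \<le> rho t" by blast
  have s: "rho s \<le> rho t" if "\<bar>t\<bar> \<le> a" for t
    using that by (intro bspec[OF s']) auto
  define M where "M = (LINT x|lborel. rho x)"
  show ?thesis
  proof (intro exI[of _ "1 + M / rho s"] allI impI)
    fix g :: "real \<Rightarrow> real" and B t
    assume g: "continuous_on UNIV g" "(LINT x|lborel. g x) = 0" "\<forall>t. \<bar>g t\<bar> \<le> B * rho t"
    have "0 \<le> B * rho 0" using g(3) abs_ge_zero order_trans by blast
    hence B: "0 \<le> B" using rho_pos[of 0] by (simp add: zero_le_mult_iff)
    have intB: "integrable lborel (\<lambda>x. B * rho x)" by (intro integrable_mult_right integrable_rho)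
    have int: "integrable lborel g"
      by (rule Bochner_Integration.integrable_bound[OF intB])
        (use g B rho_pos borel_measurable_continuous_onI[OF g(1)] in \<open>auto intro!: AE_I2 simp: abs_mult less_imp_le\<close>)
    have M: "M \<ge> 0" using mass_pos by (simp add: M_def)
    show "\<bar>tail g t\<bar> \<le> (1 + M / rho s) * B * rho t"
    proof (cases "a \<le> \<bar>t\<bar>")
      case True
      have "\<bar>tail g t\<bar> \<le> B * rho t"
      proof (rule tail_dominated[OF int g(1,2), where a = a])
        show "((\<lambda>t. B * rho t) has_real_derivative B * (2 * (y t * y' t))) (at t)" for t
          by (intro DERIV_cmult rho_deriv)
        have *: "B * rho t \<le> - (B * (2 * (y t * y' t)))" if t: "a \<le> t" for t
        proof -
          have "t ^ 1 \<le> t ^ (k + 1)" using t by (intro power_increasing) (auto simp: a_def)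
          hence "t \<le> t ^ (k + 1)" by (simp only: power_one_right)
          hence "real (k + 1) \<le> t ^ (k + 1)" using t unfolding a_def by linarith
          hence "1 \<le> p t" unfolding p_def by (simp only: le_divide_eq_1) simp
          hence "1 * y t \<le> p t * y t" using y_pos[of t] by (intro mult_right_mono) auto
          also have "\<dots> \<le> - y' t" using log_derivative_ge[of t] t by (simp add: p_def a_def)
          finally have "y t * y t \<le> y t * (- y' t)" using y_pos[of t] by (intro mult_left_mono) auto
          moreover have "0 \<le> y t * y t" by simp
          ultimately have "rho t \<le> - (2 * (y t * y' t))" unfolding rho_def power2_eq_square by linarith
          from mult_left_mono[OF this B] show ?thesis by simp
        qed
        show "\<bar>g t\<bar> \<le> - (B * (2 * (y t * y' t)))" "\<bar>g (- t)\<bar> \<le> - (B * (2 * (y t * y' t)))" if t: "a \<le> t" for t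
          using *[OF t] g(3)[rule_format, of t] g(3)[rule_format, of "- t"] by (auto simp: rho_even)
      qed (use B True rho_pos in \<open>auto simp: rho_even less_imp_le\<close>)
      also have "\<dots> = 1 * (B * rho t)" by simp
      also have "\<dots> \<le> (1 + M / rho s) * (B * rho t)"
        using B M rho_pos[of s] rho_pos[of t] by (intro mult_right_mono) auto
      finally show ?thesis by (simp add: mult.assoc)
    next
      case False
      have "\<bar>tail g t\<bar> \<le> (LINT x|lborel. \<bar>indicator {t..} x * g x\<bar>)"
        unfolding tail_def by (rule integral_abs_bound)
      also have "\<dots> \<le> (LINT x|lborel. B * rho x)"
        using g(3) B rho_pos
        by (intro integral_mono integrable_abs integrable_indicator_times int intB)
          (auto simp: indicator_def less_imp_le)
      also have "\<dots> = B * M" by (simp add: M_def)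
      also have "\<dots> = (M / rho s) * (B * rho s)" by simp
      also have "\<dots> \<le> (1 + M / rho s) * (B * rho t)"
        using B M rho_pos[of s] s[of t] False by (intro mult_mono mult_left_mono) (auto simp: less_imp_le)
      finally show ?thesis by (simp add: mult.assoc)
    qed
  qed
qed

lemma L_bound_exists: "\<exists>K>0. \<forall>f B t. continuous_on UNIV f \<longrightarrow> (\<forall>t. \<bar>f t\<bar> \<le> B) \<longrightarrow> \<bar>L f t\<bar> \<le> K * B"
proof -
  obtain K where K: "\<And>g B t. continuous_on UNIV g \<Longrightarrow> (LINT x|lborel. g x) = 0 \<Longrightarrow>
    (\<And>t. \<bar>g t\<bar> \<le> B * rho t) \<Longrightarrow> \<bar>tail g t\<bar> \<le> K * B * rho t"
    using tail_bound_exists by blast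
  \<comment> \<open>The factor 2 comes from \<open>\<bar>f - avg f\<bar> \<le> 2 * B\<close>; the
    absolute value and the summand 1 make the constant positive.\<close>
  have "\<bar>L f t\<bar> \<le> (\<bar>K\<bar> * 2 + 1) * B" if f: "continuous_on UNIV f" "\<And>t. \<bar>f t\<bar> \<le> B" for f B t
  proof -
    have B: "0 \<le> B" using f(2)[of 0] by linarith
    have "\<bar>tail (\<lambda>x. rho x * (f x - avg f)) t\<bar> \<le> K * (2 * B) * rho t"
    proof (rule K)
      show "continuous_on UNIV (\<lambda>x. rho x * (f x - avg f))"
        by (intro continuous_intros cont f(1))
      show "(LINT x|lborel. rho x * (f x - avg f)) = 0"
        using integrable_rho_bounded[OF f] integrable_rho mass_pos
        by (simp add: avg_def right_diff_distrib)
      show "\<bar>rho t * (f t - avg f)\<bar> \<le> 2 * B * rho t" for t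
      proof -
        have "\<bar>f t - avg f\<bar> \<le> 2 * B" using f(2)[of t] avg_le[OF f] by linarith
        from mult_left_mono[OF this, of "rho t"] rho_pos[of t] show ?thesis
          by (simp add: abs_mult mult_ac)
      qed
    qed
    hence "\<bar>L f t\<bar> \<le> K * (2 * B)" using rho_pos[of t] by (simp add: L_def field_simps)
    also have "\<dots> \<le> (\<bar>K\<bar> * 2 + 1) * B"
      using mult_right_mono[OF abs_ge_self[of K] B] B by (simp add: algebra_simps)
    finally show ?thesis .
  qed
  moreover have "\<bar>K\<bar> * 2 + 1 > 0" by simp
  ultimately show ?thesis by blast
qed

lemma L_deriv:
  assumes f: "continuous_on UNIV f" "\<And>t. \<bar>f t\<bar> \<le> B"
  shows "(L f has_real_derivative 2 * q t * L f t + f t - avg f) (at t)"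
proof -
  have int: "integrable lborel (\<lambda>x. rho x * (f x - avg f))"
    using integrable_rho_bounded[OF f] integrable_rho by (simp add: right_diff_distrib)
  have c: "continuous_on UNIV (\<lambda>x. rho x * (f x - avg f))"
    by (intro continuous_intros cont f(1))
  have "((\<lambda>t. - tail (\<lambda>x. rho x * (f x - avg f)) t) has_real_derivative
      - (- (rho t * (f t - avg f)))) (at t)"
    by (intro DERIV_minus tail_has_derivative[OF int c])
  from divide_rho_deriv[OF this] show ?thesis
    unfolding L_def[abs_def] by (rule DERIV_cong) simp
qed

end

section \<open>The perturbation series\<close>

text \<open>These are the Catalan numbers times \<open>K ^ n\<close>; the generating function
  satisfies \<open>B = 1 + K * x * B^2\<close>.\<close>

fun majorant :: "real \<Rightarrow> nat \<Rightarrow> real" where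
  "majorant K 0 = 1"
| "majorant K (Suc n) = K * (\<Sum>i\<le>n. majorant K i * majorant K (n - i))"

lemma majorant_nonneg: "0 \<le> K \<Longrightarrow> 0 \<le> majorant K n"
proof (induction n rule: less_induct)
  case (less n)
  thus ?case by (cases n) (auto intro!: mult_nonneg_nonneg sum_nonneg)
qed

text \<open>The convolution terms of order at most \<open>N\<close> form a triangle inside a square,
  so consecutive partial sums satisfy \<open>S (N + 1) \<le> 1 + K * x * (S N)^2\<close>. With
  \<open>4 * K * x \<le> 1\<close> the bound 2 reproduces itself.\<close>

lemma majorant_partial_sum_le:
  assumes K: "0 \<le> K" and x: "0 \<le> x" "4 * K * x \<le> 1"
  shows "(\<Sum>n\<le>N. majorant K n * x ^ n) \<le> 2"
proof (induction N)
  case (Suc N)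
  define c where "c n = majorant K n * x ^ n" for n
  have c: "0 \<le> c n" for n using majorant_nonneg[OF K] x by (simp add: c_def)
  have step: "c (Suc n) = K * x * (\<Sum>i\<le>n. c i * c (n - i))" for n
  proof -
    have "(\<Sum>i\<le>n. c i * c (n - i)) = (\<Sum>i\<le>n. (majorant K i * majorant K (n - i)) * x ^ n)"
      by (intro sum.cong) (auto simp: c_def mult_ac simp flip: power_add)
    also have "\<dots> = (\<Sum>i\<le>n. majorant K i * majorant K (n - i)) * x ^ n"
      by (rule sum_distrib_right[symmetric])
    finally show ?thesis by (simp add: c_def)
  qed
  have "(\<Sum>n\<le>N. \<Sum>i\<le>n. c i * c (n - i)) = (\<Sum>(i, j)\<in>{(i, j). i + j \<le> N}. c i * c j)"
    by (rule sum.triangle_reindex_eq[symmetric])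
  also have "\<dots> \<le> (\<Sum>(i, j)\<in>{..N} \<times> {..N}. c i * c j)"
    by (rule sum_mono2) (use c in auto)
  also have "\<dots> = (\<Sum>n\<le>N. c n)\<^sup>2"
    by (simp add: power2_eq_square sum_product sum.cartesian_product)
  also have "\<dots> \<le> 2\<^sup>2"
    using Suc.IH c by (intro power_mono sum_nonneg) (auto simp: c_def)
  finally have "K * x * (\<Sum>n\<le>N. \<Sum>i\<le>n. c i * c (n - i)) \<le> K * x * 2\<^sup>2"
    using K x by (intro mult_left_mono) auto
  moreover have "(\<Sum>n\<le>Suc N. c n) = 1 + K * x * (\<Sum>n\<le>N. \<Sum>i\<le>n. c i * c (n - i))"
    by (simp add: sum.atMost_Suc_shift step sum_distrib_left c_def[of 0] del: sum.atMost_Suc)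
  ultimately show ?case using x by (simp add: c_def mult_ac)
qed simp

lemma majorant_summable:
  assumes K: "0 \<le> K" and x: "0 \<le> x" "4 * K * x \<le> 1"
  shows "summable (\<lambda>n. majorant K n * x ^ n)" "(\<Sum>n. majorant K n * x ^ n) \<le> 2"
proof -
  have nonneg: "0 \<le> majorant K n * x ^ n" for n using majorant_nonneg[OF K] x by simp
  have "(\<Sum>i<n. majorant K i * x ^ i) \<le> 2" for n
  proof -
    have "(\<Sum>i<n. majorant K i * x ^ i) \<le> (\<Sum>i\<le>n. majorant K i * x ^ i)"
      by (rule sum_mono2) (use nonneg in auto)
    thus ?thesis using majorant_partial_sum_le[OF K x, of n] by linarith
  qed
  thus "summable (\<lambda>n. majorant K n * x ^ n)" "(\<Sum>n. majorant K n * x ^ n) \<le> 2"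
    by (auto intro!: summableI_nonneg_bounded[where x = 2] suminf_le_const nonneg)
qed

section \<open>Convergence of the power series for the perturbed logarithmic derivative\<close>

context ground_state
begin

text \<open>The coefficients of \<open>s\<close> in powers of the parameter. At order
  \<open>n + 1\<close> the equation for \<open>s\<close> becomes linear, with the order
  \<open>n\<close> part of \<open>s^2\<close> minus its average as source; \<open>L\<close> solves
  it.\<close>

fun v :: "nat \<Rightarrow> real \<Rightarrow> real" where
  "v 0 = v0"
| "v (Suc n) = L (\<lambda>t. \<Sum>i\<le>n. v i t * v (n - i) t)"

definition conv :: "nat \<Rightarrow> real \<Rightarrow> real" where "conv n t = (\<Sum>i\<le>n. v i t * v (n - i) t)"

lemma perturbation_series:
  obtains r :: real and c :: "nat \<Rightarrow> real" where "r > 0" "c 0 < 1"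
    "\<And>x. \<bar>x\<bar> \<le> r \<Longrightarrow> summable (\<lambda>n. c n * x ^ n)"
    "\<And>x. \<bar>x\<bar> \<le> r \<Longrightarrow> \<exists>s. (\<forall>t. \<bar>s t\<bar> \<le> 2) \<and>
      (\<forall>t. (s has_real_derivative 2 * q t * s t + 2 * p t + x * ((s t)\<^sup>2 - (\<Sum>n. c n * x ^ n))) (at t))"
proof -
  obtain K where K: "K > 0"
    and L_bound: "\<And>f B t. continuous_on UNIV f \<Longrightarrow> (\<And>t. \<bar>f t\<bar> \<le> B) \<Longrightarrow> \<bar>L f t\<bar> \<le> K * B"
    using L_bound_exists by blast
  \<comment> \<open>The largest radius allowed by the condition \<open>4 * K * x \<le> 1\<close> of
    the majorant series.\<close>
  define r where "r = 1 / (4 * K)"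
  have r: "r > 0" "4 * K * r \<le> 1" using K by (simp_all add: r_def)
  define B where "B = majorant K"
  define C where "C n = (\<Sum>i\<le>n. B i * B (n - i))" for n
  have B_Suc: "B (Suc n) = K * C n" for n by (simp add: B_def C_def)
  have B_nonneg: "0 \<le> B n" for n using majorant_nonneg[of K n] K by (simp add: B_def)
  have sB: "summable (\<lambda>n. B n * r ^ n)" "(\<Sum>n. B n * r ^ n) \<le> 2"
    unfolding B_def using majorant_summable[of K r] K r by auto
  \<comment> \<open>\<open>C\<close> bounds the convolutions \<open>conv n\<close>. Its summability
    comes from that of the majorant, since \<open>B (Suc n) = K * C n\<close>.\<close>
  have sC: "summable (\<lambda>n. C n * r ^ n)"
  proof -
    have "summable (\<lambda>n. B (Suc n) * r ^ Suc n)" using sB(1) by (subst summable_Suc_iff)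
    hence "summable (\<lambda>n. (1 / (K * r)) * (B (Suc n) * r ^ Suc n))" by (rule summable_mult)
    thus ?thesis using K r by (simp add: B_Suc)
  qed

  have cont_conv: "continuous_on UNIV (conv n)" and conv_bound: "\<bar>conv n t\<bar> \<le> C n"
    if "\<And>i. i \<le> n \<Longrightarrow> continuous_on UNIV (v i) \<and> (\<forall>t. \<bar>v i t\<bar> \<le> B i)" for n t
  proof -
    show "continuous_on UNIV (conv n)"
      unfolding conv_def[abs_def] using that by (intro continuous_intros) auto
    have "\<bar>conv n t\<bar> \<le> (\<Sum>i\<le>n. \<bar>v i t * v (n - i) t\<bar>)"
      unfolding conv_def by (rule sum_abs)
    also have "\<dots> \<le> C n"
      unfolding C_def abs_mult using that B_nonneg by (intro sum_mono mult_mono) auto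
    finally show "\<bar>conv n t\<bar> \<le> C n" .
  qed
  have v_Suc: "v (Suc n) = L (conv n)" for n
    by (simp add: conv_def[abs_def])
  have v: "continuous_on UNIV (v n) \<and> (\<forall>t. \<bar>v n t\<bar> \<le> B n)" for n
  proof (induction n rule: less_induct)
    case (less n)
    show ?case
    proof (cases n)
      case 0
      thus ?thesis using v0_bound v0_deriv
        by (auto simp: B_def intro!: continuous_at_imp_continuous_on DERIV_isCont)
    next
      case (Suc m)
      have IH: "continuous_on UNIV (v i) \<and> (\<forall>t. \<bar>v i t\<bar> \<le> B i)" if "i \<le> m" for i
        using less.IH[of i] that Suc by simp
      note cb = cont_conv[OF IH] conv_bound[OF IH]
      have "continuous_on UNIV (v (Suc m))"
        unfolding v_Suc
        by (intro continuous_at_imp_continuous_on ballI DERIV_isCont[OF L_deriv[OF cb]])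
      moreover have "\<bar>v (Suc m) t\<bar> \<le> B (Suc m)" for t
        unfolding v_Suc B_Suc by (rule L_bound[OF cb])
      ultimately show ?thesis using Suc by simp
    qed
  qed
  note cont_conv = cont_conv[OF v] and conv_bound = conv_bound[OF v]
  have v_bound: "\<bar>v n t\<bar> \<le> B n" for n t using v by blast

  define c where "c n = avg (conv n)" for n
  have c_bound: "\<bar>c n\<bar> \<le> C n" for n
    unfolding c_def by (rule avg_le[OF cont_conv conv_bound])
  have "conv 0 = (\<lambda>t. (v0 t)\<^sup>2)" by (simp add: conv_def[abs_def] power2_eq_square)
  hence c0: "c 0 < 1" using avg_v0_square_less_1 by (simp add: c_def)

  \<comment> \<open>The source term of order \<open>n\<close>: \<open>2 * p\<close> enters at order
    0, and the factor \<open>x\<close> in front of the quadratic term shifts the convolutions by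
    one.\<close>
  define g where "g n t = (case n of 0 \<Rightarrow> 2 * p t | Suc m \<Rightarrow> conv m t - c m)" for n t
  have v_deriv: "(v n has_real_derivative 2 * q t * v n t + g n t) (at t)" for n t
  proof (cases n)
    case 0
    thus ?thesis using v0_deriv by (simp add: g_def)
  next
    case (Suc m)
    show ?thesis
      using L_deriv[OF cont_conv conv_bound, of m t] unfolding Suc v_Suc by (simp add: g_def c_def add_diff_eq)
  qed

  have power_le: "\<bar>x ^ n\<bar> \<le> r ^ n" if "\<bar>x\<bar> \<le> r" for x and n :: nat
    using power_mono[OF that, of n] by (simp add: power_abs)
  have summ: "summable (\<lambda>n. norm (a n * x ^ n))"
    if "\<And>n. \<bar>a n\<bar> \<le> A n" "summable (\<lambda>n. A n * r ^ n)" "\<bar>x\<bar> \<le> r" for a A :: "nat \<Rightarrow> real" and x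
  proof (rule summable_comparison_test'[OF that(2)])
    fix n :: nat
    have "0 \<le> A n" using that(1)[of n] by linarith
    thus "norm (norm (a n * x ^ n)) \<le> A n * r ^ n"
      using mult_mono[OF that(1)[of n] power_le[OF that(3), of n]] by (simp add: abs_mult)
  qed

  have sc: "summable (\<lambda>n. c n * x ^ n)" if "\<bar>x\<bar> \<le> r" for x
    by (rule summable_norm_cancel[OF summ[OF c_bound sC that]])

  have sol: "\<exists>s. (\<forall>t. \<bar>s t\<bar> \<le> 2) \<and>
      (\<forall>t. (s has_real_derivative 2 * q t * s t + 2 * p t + x * ((s t)\<^sup>2 - (\<Sum>n. c n * x ^ n))) (at t))"
    if x: "\<bar>x\<bar> \<le> r" for x
  proof (intro exI conjI allI)
    define s where "s t = (\<Sum>n. v n t * x ^ n)" for t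
    have sn: "summable (\<lambda>n. norm (v n t * x ^ n))" for t
      by (rule summ[OF v_bound sB(1) x])
    have ss: "(\<lambda>n. v n t * x ^ n) sums s t" for t
      unfolding s_def by (rule summable_sums[OF summable_norm_cancel[OF sn]])
    fix t :: real
    have "\<bar>s t\<bar> \<le> (\<Sum>n. norm (v n t * x ^ n))"
      unfolding s_def using summable_norm[OF sn[of t]] by simp
    also have "\<dots> \<le> (\<Sum>n. B n * r ^ n)"
    proof (rule suminf_le[OF _ sn sB(1)])
      show "norm (v n t * x ^ n) \<le> B n * r ^ n" for n
        using mult_mono[OF v_bound[of n t] power_le[OF x, of n] B_nonneg[of n]] by (simp add: abs_mult)
    qed
    finally show "\<bar>s t\<bar> \<le> 2" using sB(2) by linarith

    \<comment> \<open>The derivatives involve \<open>p\<close> and \<open>q\<close>, which are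
      bounded only on compact intervals, so termwise differentiation is justified on a neighbourhood
      of \<open>t\<close>.\<close>
    define T where "T = \<bar>t\<bar> + 1"
    have bnd: "\<exists>M. \<forall>z\<in>{-T..T}. \<bar>f z\<bar> \<le> M" if "continuous_on {-T..T} f" for f :: "real \<Rightarrow> real"
    proof -
      have "bounded (f ` {-T..T})" by (intro compact_imp_bounded compact_continuous_image that) auto
      thus ?thesis unfolding bounded_iff by auto
    qed
    obtain Q where Q: "\<And>z. z \<in> {-T..T} \<Longrightarrow> \<bar>q z\<bar> \<le> Q" using bnd[OF cont(4)] by blast
    obtain P where P: "\<And>z. z \<in> {-T..T} \<Longrightarrow> \<bar>p z\<bar> \<le> P" using bnd[OF cont(3)] by blast
    define G where "G n = (case n of 0 \<Rightarrow> 2 * P | Suc m \<Rightarrow> 2 * C m)" for n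
    have g_bound: "\<bar>g n z\<bar> \<le> G n" if z: "z \<in> {-T..T}" for n z
    proof (cases n)
      case 0
      thus ?thesis using P[OF z] by (simp add: g_def G_def abs_mult)
    next
      case (Suc m)
      thus ?thesis using conv_bound[of m z] c_bound[of m] by (simp add: g_def G_def)
    qed
    have sG: "summable (\<lambda>n. G n * r ^ n)"
    proof (subst summable_Suc_iff[symmetric])
      have "summable (\<lambda>n. (2 * r) * (C n * r ^ n))" by (intro summable_mult sC)
      thus "summable (\<lambda>n. G (Suc n) * r ^ Suc n)" by (simp add: G_def mult_ac)
    qed
    have "((\<lambda>t. \<Sum>n. v n t * x ^ n) has_real_derivative (\<Sum>n. (2 * q t * v n t + g n t) * x ^ n)) (at t)"
    proof (rule has_field_derivative_series'(2)[where S = "{-T..T}" and ?x0.0 = t])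
      show "((\<lambda>t. v n t * x ^ n) has_real_derivative (2 * q z * v n z + g n z) * x ^ n) (at z within {-T..T})" for n z
        by (intro DERIV_subset[OF DERIV_cmult_right[OF v_deriv]]) auto
      show "uniformly_convergent_on {-T..T} (\<lambda>n z. \<Sum>i<n. (2 * q z * v i z + g i z) * x ^ i)"
      proof (rule Weierstrass_m_test')
        show "summable (\<lambda>n. 2 * Q * (B n * r ^ n) + G n * r ^ n)"
          by (intro summable_add summable_mult sB(1) sG)
        fix n z assume z: "z \<in> {-T..T}"
        have "0 \<le> Q" "0 \<le> G n" using Q[OF z] g_bound[OF z, of n] by linarith+
        have "\<bar>2 * q z * v n z + g n z\<bar> \<le> \<bar>2 * q z * v n z\<bar> + \<bar>g n z\<bar>" by (rule abs_triangle_ineq)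
        also have "\<bar>2 * q z * v n z\<bar> \<le> 2 * Q * B n"
          unfolding abs_mult using Q[OF z] v_bound[of n z] \<open>0 \<le> Q\<close> by (intro mult_mono) auto
        finally have "\<bar>2 * q z * v n z + g n z\<bar> \<le> 2 * Q * B n + G n" using g_bound[OF z, of n] by linarith
        hence "\<bar>2 * q z * v n z + g n z\<bar> * \<bar>x ^ n\<bar> \<le> (2 * Q * B n + G n) * r ^ n"
          using power_le[OF x, of n] \<open>0 \<le> Q\<close> \<open>0 \<le> G n\<close> B_nonneg[of n] by (intro mult_mono) auto
        also have "\<dots> = 2 * Q * (B n * r ^ n) + G n * r ^ n" by (simp add: algebra_simps)
        finally show "norm ((2 * q z * v n z + g n z) * x ^ n) \<le> 2 * Q * (B n * r ^ n) + G n * r ^ n"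
          by (simp only: real_norm_def abs_mult)
      qed
      show "summable (\<lambda>n. v n t * x ^ n)" by (rule summable_norm_cancel[OF sn])
    qed (auto simp: T_def)
    moreover have "(\<lambda>n. (2 * q t * v n t + g n t) * x ^ n) sums
        (2 * q t * s t + (2 * p t + x * ((s t)\<^sup>2 - (\<Sum>n. c n * x ^ n))))"
    proof -
      have "(\<lambda>k. \<Sum>i\<le>k. (v i t * x ^ i) * (v (k - i) t * x ^ (k - i))) sums
          ((\<Sum>n. v n t * x ^ n) * (\<Sum>n. v n t * x ^ n))"
        by (rule Cauchy_product_sums[OF sn sn])
      moreover have "(\<Sum>i\<le>k. (v i t * x ^ i) * (v (k - i) t * x ^ (k - i))) = conv k t * x ^ k" for k
        unfolding conv_def sum_distrib_right
        by (intro sum.cong) (auto simp: mult_ac simp flip: power_add)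
      ultimately have sq: "(\<lambda>k. conv k t * x ^ k) sums (s t)\<^sup>2"
        by (simp add: s_def power2_eq_square)
      have "(\<lambda>n. x * (conv n t * x ^ n - c n * x ^ n)) sums (x * ((s t)\<^sup>2 - (\<Sum>n. c n * x ^ n)))"
        by (intro sums_mult sums_diff sq summable_sums[OF sc[OF x]])
      hence "(\<lambda>n. g (Suc n) t * x ^ Suc n) sums (x * ((s t)\<^sup>2 - (\<Sum>n. c n * x ^ n)))"
        by (simp add: g_def algebra_simps)
      hence "(\<lambda>n. g n t * x ^ n) sums (x * ((s t)\<^sup>2 - (\<Sum>n. c n * x ^ n)) + g 0 t * x ^ 0)"
        by (rule sums_Suc)
      from sums_add[OF sums_mult[OF ss[of t], of "2 * q t"] this]
      show ?thesis by (simp add: g_def algebra_simps)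
    qed
    ultimately show "(s has_real_derivative 2 * q t * s t + 2 * p t +
        x * ((s t)\<^sup>2 - (\<Sum>n. c n * x ^ n))) (at t)"
      unfolding s_def[abs_def] by (simp add: sums_iff add.assoc)
  qed
  from that[OF r(1) c0 sc sol] show ?thesis .
qed

end

section \<open>Non-degeneracy of the minimum\<close>

lemma antiderivative_exists:
  fixes f :: "real \<Rightarrow> real"
  assumes f: "continuous_on UNIV f"
  obtains F where "\<And>t. (F has_real_derivative f t) (at t)"
proof
  fix t :: real
  define a where "a = - \<bar>t\<bar> - 1"
  define b where "b = \<bar>t\<bar> + 1"
  have "((\<lambda>u. LBINT y=ereal 0..u. f y) has_vector_derivative f t) (at t within {a..b})"
    by (rule interval_integral_FTC2) (auto simp: a_def b_def intro: continuous_on_subset[OF f])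
  thus "((\<lambda>u. LBINT y=ereal 0..u. f y) has_real_derivative f t) (at t)"
    unfolding has_real_derivative_iff_has_vector_derivative
    by (subst (asm) at_within_Icc_at) (auto simp: a_def b_def)
qed

text \<open>For \<open>u = y * exp (- x * S)\<close> with \<open>S' = s\<close>, the logarithmic
  derivative gives \<open>- u' / u = q + x * s\<close>. Completing squares in the equations for
  \<open>q\<close> and \<open>s\<close> leaves \<open>(q + x * s)' = lam + x^2 * (1 - N) - (p - x)^2
  + (q + x * s)^2\<close>, the Riccati form of the eigenvalue equation at \<open>x\<close>.\<close>

lemma (in ground_state) lowest_eigenvalue_perturbed:
  assumes x: "\<bar>x\<bar> \<le> 1/4" and s_bound: "\<And>t. \<bar>s t\<bar> \<le> 2"
    and s: "\<And>t. (s has_real_derivative 2 * q t * s t + 2 * p t + x * ((s t)\<^sup>2 - N)) (at t)"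
  shows "lowest_eigenvalue k x = lam + x\<^sup>2 * (1 - N)"
proof -
  have "continuous_on UNIV s"
    by (intro continuous_at_imp_continuous_on ballI DERIV_isCont[OF s])
  then obtain S where S: "\<And>t. (S has_real_derivative s t) (at t)"
    using antiderivative_exists by blast
  define u where "u t = y t * exp (- x * S t)" for t
  define u' where "u' t = (y' t - x * s t * y t) * exp (- x * S t)" for t
  have u_pos: "u t > 0" for t using y_pos[of t] by (simp add: u_def)
  have u: "(u has_real_derivative u' t) (at t)" for t
    unfolding u_def[abs_def] u'_def
    by (rule derivative_eq_intros y S refl)+ (simp add: algebra_simps)
  have y'_eq: "y' t = - q t * y t" for t by (simp add: q_def)
  have u': "(u' has_real_derivative (Qpot k x t - (lam + x\<^sup>2 * (1 - N))) * u t) (at t)" for t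
  proof -
    have y'': "(y' has_real_derivative ((p t)\<^sup>2 - lam) * y t) (at t)"
      using y'[of t] by (simp add: p_def)
    have Q: "Qpot k x t = (p t - x)\<^sup>2" by (simp only: Qpot_def p_def)
    show ?thesis
      unfolding u'_def[abs_def]
      by (rule derivative_eq_intros y y'' S s refl)+
        (simp add: Q u_def y'_eq algebra_simps power2_eq_square)
  qed
  \<comment> \<open>The bounds 1/4 and 2 multiply to exactly the margin 1/2 of
    \<open>ground_state_square_integrable\<close>.\<close>
  have xs: "\<bar>x * s t\<bar> \<le> 1/2" for t
    using mult_mono[OF x s_bound[of t]] by (simp add: abs_mult)
  have right: "u' t \<le> (1/2 - t ^ (k + 1) / real (k + 1)) * u t" if "0 \<le> t" for t
  proof -
    have "- (x * s t) * y t \<le> 1/2 * y t"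
      using xs[of t] y_pos[of t] by (intro mult_right_mono) auto
    hence "y' t - x * s t * y t \<le> (1/2 - t ^ (k + 1) / real (k + 1)) * y t"
      using log_derivative_ge[OF that] unfolding left_diff_distrib by simp
    from mult_right_mono[OF this, of "exp (- x * S t)"] show ?thesis
      by (simp add: u_def u'_def mult.assoc)
  qed
  have left: "(- 1/2 - t ^ (k + 1) / real (k + 1)) * u t \<le> u' t" if t: "t \<le> 0" for t
  proof -
    have "p (- t) * y (- t) \<le> - y' (- t)" using log_derivative_ge[of "- t"] t by (simp add: p_def)
    hence 1: "- (p t * y t) \<le> y' t" by (simp add: p_odd y_even y'_odd)
    have 2: "x * s t * y t \<le> 1/2 * y t"
      using xs[of t] y_pos[of t] by (intro mult_right_mono) auto
    have "(- 1/2 - p t) * y t = - (1/2 * y t) - p t * y t" by (simp add: algebra_simps)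
    hence "(- 1/2 - p t) * y t \<le> y' t - x * s t * y t" using 1 2 by linarith
    from mult_right_mono[OF this, of "exp (- x * S t)"] show ?thesis
      by (simp add: u_def u'_def mult.assoc p_def)
  qed
  have "\<bar>x\<bar> \<le> 1" using x by simp
  note int = ground_state_square_integrable[OF k(1) this u_pos u u' right left]
  show ?thesis by (rule lowest_eigenvalue_eqI[OF u_pos u u' int])
qed

lemma ground_state_exists:
  assumes k: "even k" "k \<ge> 2"
  obtains lam y y' where "ground_state k lam y y'"
proof -
  have V: "1 / (real (k + 1))\<^sup>2 * t ^ (2 * (k + 1)) = (t ^ (k + 1) / real (k + 1))\<^sup>2" for t :: real
    unfolding power_even_eq by (simp add: power_divide)
  obtain lam :: real and y y' where *: "lam > 0" "y 0 = 1" "y' 0 = 0"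
    "\<And>t. (y has_real_derivative y' t) (at t)"
    "\<And>t. (y' has_real_derivative ((t ^ (k + 1) / real (k + 1))\<^sup>2 - lam) * y t) (at t)"
    "\<And>t. y t > 0" "\<And>t. 0 \<le> t \<Longrightarrow> y' t \<le> 0"
    "\<And>t. y (- t) = y t" "\<And>t. y' (- t) = - y' t"
    using shooting_ground_state[of "k + 1"] unfolding V by auto
  have "ground_state k lam y y'"
  proof
    show "t ^ (k + 1) / real (k + 1) * y t \<le> - y' t" if "0 \<le> t" for t
      by (rule ground_state_log_derivative_ge[OF _ *(4,5,6,7,3) that]) auto
  qed (use k * in auto)
  thus ?thesis by (rule that)
qed

theorem theorem1p2:
  fixes k :: nat
  assumes "even k" and "k \<ge> 2"
  shows "(lowest_eigenvalue k has_real_derivative 0) (at 0) \<and>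
         (\<exists>D2 > 0. (deriv (lowest_eigenvalue k) has_real_derivative D2) (at 0))"
proof -
  obtain lam y y' where "ground_state k lam y y'" using ground_state_exists[OF assms] .
  then interpret ground_state k lam y y' .
  obtain r c where r: "r > 0" and c0: "c 0 < 1"
    and sc: "\<And>x. \<bar>x\<bar> \<le> r \<Longrightarrow> summable (\<lambda>n. c n * x ^ n)"
    and sol: "\<And>x. \<bar>x\<bar> \<le> r \<Longrightarrow> \<exists>s. (\<forall>t. \<bar>s t\<bar> \<le> 2) \<and>
      (\<forall>t. (s has_real_derivative 2 * q t * s t + 2 * p t + x * ((s t)\<^sup>2 - (\<Sum>n. c n * x ^ n))) (at t))"
    by (rule perturbation_series) blast
  define N where "N x = (\<Sum>n. c n * x ^ n)" for x
  define M where "M x = (\<Sum>n. diffs c n * x ^ n)" for x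
  define d where "d = min r (1/4)"
  have d: "d > 0" using r by (simp add: d_def)
  have N: "(N has_real_derivative M x) (at x)" if "\<bar>x\<bar> < d" for x
    unfolding N_def[abs_def] M_def
    by (rule termdiffs_strong'[where K = d]) (use that sc in \<open>auto simp: d_def\<close>)
  have M: "(M has_real_derivative (\<Sum>n. diffs (diffs c) n * x ^ n)) (at x)" if "\<bar>x\<bar> < d" for x
    unfolding M_def[abs_def]
    by (rule termdiffs_strong'[where K = d])
      (use that sc in \<open>auto simp: d_def intro!: termdiff_converges[where K = d]\<close>)
  have eq: "lam + x\<^sup>2 * (1 - N x) = lowest_eigenvalue k x" if x: "x \<in> {-d<..<d}" for x
  proof -
    have "\<bar>x\<bar> \<le> r" "\<bar>x\<bar> \<le> 1/4" using x by (auto simp: d_def)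
    obtain s where "\<And>t. \<bar>s t\<bar> \<le> 2"
      "\<And>t. (s has_real_derivative 2 * q t * s t + 2 * p t + x * ((s t)\<^sup>2 - N x)) (at t)"
      using sol[OF \<open>\<bar>x\<bar> \<le> r\<close>] unfolding N_def by blast
    from lowest_eigenvalue_perturbed[OF \<open>\<bar>x\<bar> \<le> 1/4\<close> this] show ?thesis by simp
  qed
  \<comment> \<open>The derivative of \<open>lam + x^2 * (1 - N x)\<close>. This formula equals the
    lowest eigenvalue on an open interval around 0, so it determines both derivatives at 0; the
    second is \<open>2 * (1 - c 0)\<close>.\<close>
  define D where "D x = 2 * x * (1 - N x) - x\<^sup>2 * M x" for x
  have der: "(lowest_eigenvalue k has_real_derivative D x) (at x)" if x: "x \<in> {-d<..<d}" for x
  proof (rule has_field_derivative_transform_within_open[OF _ _ x eq])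
    have "\<bar>x\<bar> < d" using x by auto
    thus "((\<lambda>x. lam + x\<^sup>2 * (1 - N x)) has_real_derivative D x) (at x)"
      by (auto intro!: derivative_eq_intros N simp: D_def)
  qed auto
  have D: "(D has_real_derivative 2 * (1 - c 0)) (at 0)"
  proof -
    have "N 0 = c 0" by (simp add: N_def)
    thus ?thesis unfolding D_def[abs_def] using d by (auto intro!: derivative_eq_intros N M)
  qed
  have "(deriv (lowest_eigenvalue k) has_real_derivative 2 * (1 - c 0)) (at 0)"
  proof (rule has_field_derivative_transform_within_open[OF D])
    show "D x = deriv (lowest_eigenvalue k) x" if "x \<in> {-d<..<d}" for x
      using DERIV_imp_deriv[OF der[OF that]] by simp
  qed (use d in auto)
  moreover have "(lowest_eigenvalue k has_real_derivative 0) (at 0)"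
    using der[of 0] d by (simp add: D_def)
  ultimately show ?thesis using c0 by (intro conjI exI[of _ "2 * (1 - c 0)"]) auto
qed

end
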